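(* Let $N$ be a prime number and let $d$ be an integer with $1<d<N$. Define numbers $\alpha_c$, for all $c\in\mathbb{N}$ such that $c\mid N-1$ and ($c\mid d$ or $c\mid d-1$), by the following backwards recursion (in which empty products equal $1$ and empty sums equal $0$). If $c>1$, $c\mid N-1$ and $c\mid d$: $$\alpha_c := \frac{(N-1-c)(N-1-2c)\cdots\left(N-1-\left(\frac{d}{c}-1\right)c\right)}{c^{\frac{d}{c}-1}\,(d/c)!} - \frac{c}{N-1}\sum_{\substack{c<b<N\\ c\mid b,\ b\mid d,\ b\mid N-1}}\left(\frac{N-1}{b}\right)\alpha_b .$$ If $c>1$, $c\mid N-1$ and $c\mid d-1$: $$\alpha_c := \frac{(N-1-c)(N-1-2c)\cdots\left(N-1-\left(\frac{d-1}{c}-1\right)c\right)}{c^{\frac{d-1}{c}-1}\,((d-1)/c)!} - \frac{c}{N-1}\sum_{\substack{c<b<N\\ c\mid b,\ b\mid d-1,\ b\mid N-1}}\left(\frac{N-1}{b}\right)\alpha_b .$$ Finally, $$\alpha_1 := \frac{1}{N-1}\binom{N}{d}-\sum_{\substack{c\mid d,\ c\mid N-1\\ c>1}}\frac{\alpha_c}{c}-\sum_{\substack{c\mid d-1,\ c\mid N-1\\ c>1}}\frac{\alpha_c}{c}.$$ Then each $\alpha_c$ is a nonnegative integer, and the total number of harmonic frames for $\mathbb{C}^d$ with $N$ elements, counted up to unitary equivalence, is $$\alpha_1+\sum_{\substack{c\mid d,\ c\mid N-1\\ c>1}}\alpha_c+\sum_{\substack{c\mid d-1,\ c\mid N-1\\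 c>1}}\alpha_c .$$
   Context: Let $G$ be a finite abelian group of order $N$ with characters $\xi_1,\ldots,\xi_N$ (the $N$ group homomorphisms $G\to\mathbb{C}^\times$), let $J\subseteq\{1,\ldots,N\}$ with $|J|=d$, and let $U:\mathbb{C}^{d}\to\mathbb{C}^{d}$ be unitary. The set of vectors $\Phi=U\{(\xi_j(g))_{j\in J}: g\in G\}\subset\mathbb{C}^{d}$ is called a harmonic frame for $\mathbb{C}^d$ (with $N$ elements). Two harmonic frames $\Phi,\Psi\subset\mathbb{C}^d$ with $N$ elements are equivalent if there is a unitary transformation $V$ of $\mathbb{C}^d$ with $\Phi=V\Psi$ as sets; the number of harmonic frames means the number of equivalence classes. *)

theory Defs
  imports
    "HOL-Computational_Algebra.Primes"
    "HOL-Algebra.Algebraic_Closure_Type"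
    "Jordan_Normal_Form.Schur_Decomposition"
begin

section \<open>Harmonic frames\<close>

text \<open>
  A character is a homomorphism into the group of units of the complex numbers. It is required to
  be \<open>undefined\<close> outside the carrier, so that characters agreeing on the group are equal as
  functions and a finite abelian group of order \<open>N\<close> has exactly \<open>N\<close> of them.
\<close>

definition characters :: "('a, 'b) monoid_scheme \<Rightarrow> ('a \<Rightarrow> complex) set" where
  "characters G =
     hom G (units_of (ring_of_type_algebra :: complex ring)) \<inter> extensional (carrier G)"

definition unitary :: "nat \<Rightarrow> complex mat \<Rightarrow> bool" where
  "unitary d U \<longleftrightarrow> U \<in> carrier_mat d d \<and> mat_adjoint U * U = 1\<^sub>m d \<and> U * mat_adjoint U = 1\<^sub>m d"

text \<open>
  The set \<open>J\<close> of \<open>d\<close> distinct characters is identified with the coordinates of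
  \<open>\<complex>\<^sup>d\<close> by an enumeration \<open>\<xi>\<close> of \<open>J\<close>; different enumerations differ by
  a permutation matrix, which is unitary.
\<close>

definition harmonic_frame_of :: "('a, 'b) monoid_scheme \<Rightarrow> nat \<Rightarrow> complex vec set \<Rightarrow> bool" where
  "harmonic_frame_of G d \<Phi> \<longleftrightarrow>
     (\<exists>J \<xi> U. J \<subseteq> characters G \<and> card J = d \<and> bij_betw \<xi> {..<d} J \<and> unitary d U \<and>
        \<Phi> = (\<lambda>g. U *\<^sub>v vec d (\<lambda>j. \<xi> j g)) ` carrier G)"

text \<open>
  All finite abelian groups of order \<open>N\<close> are admitted. Letting \<open>G\<close> range over groups whose
  carrier consists of natural numbers is no restriction, see \<open>harmonic_frame_of_imp_in\<close>.
\<close>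

definition harmonic_frames :: "nat \<Rightarrow> nat \<Rightarrow> complex vec set set" where
  "harmonic_frames N d =
     {\<Phi>. \<exists>G :: nat monoid. comm_group G \<and> finite (carrier G) \<and> card (carrier G) = N \<and>
            harmonic_frame_of G d \<Phi>}"

definition frame_equiv :: "nat \<Rightarrow> nat \<Rightarrow> complex vec set rel" where
  "frame_equiv N d =
     {(\<Phi>, \<Psi>). \<Phi> \<in> harmonic_frames N d \<and> \<Psi> \<in> harmonic_frames N d \<and>
        (\<exists>V. unitary d V \<and> \<Phi> = (\<lambda>v. V *\<^sub>v v) ` \<Psi>)}"

lemma harmonic_frame_of_imp_in:
  fixes G :: "'a monoid"
  assumes G: "comm_group G" "finite (carrier G)" and fr: "harmonic_frame_of G d \<Phi>"
  shows "\<Phi> \<in> harmonic_frames (card (carrier G)) d"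
proof -
  interpret G: comm_group G by fact
  obtain f :: "'a \<Rightarrow> nat" where f: "inj_on f (carrier G)"
    using finite_imp_inj_to_nat_seg[OF G(2)] by blast
  define k where "k = inv_into (carrier G) f"
  have kf: "k (f x) = x" if "x \<in> carrier G" for x
    using that f by (simp add: k_def)
  define H where
    "H = \<lparr>carrier = f ` carrier G, monoid.mult = (\<lambda>x y. f (k x \<otimes>\<^bsub>G\<^esub> k y)), one = f \<one>\<^bsub>G\<^esub>\<rparr>"
  have carH: "carrier H = f ` carrier G" by (simp add: H_def)
  have H: "comm_group H"
  proof (rule comm_groupI)
    show "\<exists>y\<in>carrier H. y \<otimes>\<^bsub>H\<^esub> x = \<one>\<^bsub>H\<^esub>" if "x \<in> carrier H" for x
      using that by (auto simp: H_def kf intro!: bexI[of _ "inv\<^bsub>G\<^esub> (k x)"])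
  qed (auto simp: H_def kf G.m_ac)
  have bij: "bij_betw f (carrier G) (carrier H)"
    using f by (simp add: bij_betw_def carH)
  have kh: "k \<in> hom H G"
    by (auto simp: hom_def H_def kf)
  obtain J \<xi> U where J: "J \<subseteq> characters G" "card J = d" "bij_betw \<xi> {..<d} J" "unitary d U"
    and Phi: "\<Phi> = (\<lambda>g. U *\<^sub>v vec d (\<lambda>j. \<xi> j g)) ` carrier G"
    using fr unfolding harmonic_frame_of_def by blast
  define t where "t = (\<lambda>\<chi>::'a \<Rightarrow> complex. restrict (\<lambda>y. \<chi> (k y)) (carrier H))"
  have tf: "t \<chi> (f x) = \<chi> x" if "x \<in> carrier G" for \<chi> x
    using that by (simp add: t_def carH kf)
  have tchar: "t \<chi> \<in> characters H" if "\<chi> \<in> characters G" for \<chi>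
  proof -
    have "(\<lambda>y. \<chi> (k y)) \<in> hom H (units_of (ring_of_type_algebra :: complex ring))"
      using hom_compose[OF kh] that by (auto simp: characters_def comp_def)
    then show ?thesis
      by (auto simp: characters_def t_def hom_def H_def kf Pi_iff)
  qed
  have tinj: "inj_on t (characters G)"
  proof (rule inj_onI)
    fix \<chi> \<psi> assume a: "\<chi> \<in> characters G" "\<psi> \<in> characters G" "t \<chi> = t \<psi>"
    show "\<chi> = \<psi>"
    proof (rule extensionalityI[of _ "carrier G"])
      show "\<chi> x = \<psi> x" if "x \<in> carrier G" for x
        using tf[OF that, of \<chi>] tf[OF that, of \<psi>] a(3) by simp
    qed (use a in \<open>auto simp: characters_def\<close>)
  qed
  have tJ: "bij_betw t J (t ` J)"
    using inj_on_subset[OF tinj J(1)] by (simp add: bij_betw_def)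
  have "harmonic_frame_of H d \<Phi>"
    unfolding harmonic_frame_of_def
  proof (intro exI conjI)
    show "t ` J \<subseteq> characters H" using tchar J(1) by auto
    show "card (t ` J) = d" using bij_betw_same_card[OF tJ] J(2) by simp
    show "bij_betw (t \<circ> \<xi>) {..<d} (t ` J)" using bij_betw_trans[OF J(3) tJ] .
    show "unitary d U" by fact
    show "\<Phi> = (\<lambda>g. U *\<^sub>v vec d (\<lambda>j. (t \<circ> \<xi>) j g)) ` carrier H"
      unfolding Phi carH image_image by (intro image_cong refl) (simp add: tf)
  qed
  moreover have "finite (carrier H)" "card (carrier H) = card (carrier G)"
    using G(2) bij_betw_same_card[OF bij] by (auto simp: carH)
  ultimately show ?thesis
    unfolding harmonic_frames_def using H by blast
qed

lemma unitary_one: "unitary d (1\<^sub>m d)"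
proof -
  have "mat_adjoint (1\<^sub>m d) = (1\<^sub>m d :: complex mat)"
    by (rule eq_matI) (auto simp: mat_adjoint_def mat_of_rows_def)
  then show ?thesis by (simp add: unitary_def)
qed

lemma unitary_adjoint:
  assumes "unitary d U" shows "unitary d (mat_adjoint U)"
proof -
  have U: "U \<in> carrier_mat d d" using assms by (simp add: unitary_def)
  have "mat_adjoint (mat_adjoint U) = U"
    using U by (intro eq_matI) (auto simp: mat_adjoint_def mat_of_rows_def)
  moreover have "mat_adjoint U \<in> carrier_mat d d"
    using U by (auto simp: mat_adjoint_def)
  ultimately show ?thesis using assms by (simp add: unitary_def)
qed

lemma unitary_mult:
  assumes "unitary d U" "unitary d V" shows "unitary d (U * V)"
proof -
  let ?U = "mat_adjoint U" and ?V = "mat_adjoint V"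
  have c: "U \<in> carrier_mat d d" "V \<in> carrier_mat d d" 
    "?U \<in> carrier_mat d d" "?V \<in> carrier_mat d d"
    using assms unitary_adjoint by (auto simp: unitary_def)
  have e: "?U * U = 1\<^sub>m d" "U * ?U = 1\<^sub>m d" "?V * V = 1\<^sub>m d" "V * ?V = 1\<^sub>m d"
    using assms by (auto simp: unitary_def)
  have ad: "mat_adjoint (U * V) = ?V * ?U"
    using c by (intro eq_matI)
      (auto simp: mat_adjoint_def mat_of_rows_def scalar_prod_def mult.commute)
  have "?V * ?U * (U * V) = ?V * (?U * U * V)" "U * V * (?V * ?U) = U * (V * ?V * ?U)"
    using c by (simp_all add: assoc_mult_mat[of _ d d _ d _ d])
  then show ?thesis using c e by (simp add: unitary_def ad)
qed

lemma harmonic_frame_carrier: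
  assumes "\<Phi> \<in> harmonic_frames N d" shows "\<Phi> \<subseteq> carrier_vec d"
  using assms by (auto simp: harmonic_frames_def harmonic_frame_of_def unitary_def)

lemma equiv_frame_equiv: "equiv (harmonic_frames N d) (frame_equiv N d)"
proof (rule equivI)
  show "frame_equiv N d \<subseteq> harmonic_frames N d \<times> harmonic_frames N d"
    by (auto simp: frame_equiv_def)
  show "refl_on (harmonic_frames N d) (frame_equiv N d)"
  proof (rule refl_onI)
    fix \<Phi> assume P: "\<Phi> \<in> harmonic_frames N d"
    have "\<Phi> = (\<lambda>v. 1\<^sub>m d *\<^sub>v v) ` \<Phi>"
      using harmonic_frame_carrier[OF P] by (force simp: image_iff)
    then show "(\<Phi>, \<Phi>) \<in> frame_equiv N d"
      using P unitary_one by (auto simp: frame_equiv_def)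
  qed
  show "sym (frame_equiv N d)"
  proof (rule symI)
    fix \<Phi> \<Psi> assume "(\<Phi>, \<Psi>) \<in> frame_equiv N d"
    then obtain V where P: "\<Phi> \<in> harmonic_frames N d" "\<Psi> \<in> harmonic_frames N d"
      and V: "unitary d V" "\<Phi> = (\<lambda>v. V *\<^sub>v v) ` \<Psi>"
      by (auto simp: frame_equiv_def)
    have c: "V \<in> carrier_mat d d" "mat_adjoint V \<in> carrier_mat d d"
      using V(1) unitary_adjoint[OF V(1)] by (auto simp: unitary_def)
    have "mat_adjoint V *\<^sub>v (V *\<^sub>v v) = v" if "v \<in> \<Psi>" for v
    proof -
      have v: "v \<in> carrier_vec d" using that harmonic_frame_carrier[OF P(2)] by auto
      have "mat_adjoint V *\<^sub>v (V *\<^sub>v v) = (mat_adjoint V * V) *\<^sub>v v"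
        using assoc_mult_mat_vec[OF c(2,1) v] by simp
      then show ?thesis using V(1) v by (simp add: unitary_def)
    qed
    then have "\<Psi> = (\<lambda>v. mat_adjoint V *\<^sub>v v) ` \<Phi>"
      unfolding V(2) image_image by simp
    then show "(\<Psi>, \<Phi>) \<in> frame_equiv N d"
      using P unitary_adjoint[OF V(1)] by (auto simp: frame_equiv_def)
  qed
  show "trans (frame_equiv N d)"
  proof (rule transI)
    fix \<Phi> \<Psi> \<Theta> assume "(\<Phi>, \<Psi>) \<in> frame_equiv N d" "(\<Psi>, \<Theta>) \<in> frame_equiv N d"
    then obtain V W where P: "\<Phi> \<in> harmonic_frames N d" "\<Theta> \<in> harmonic_frames N d"
      and V: "unitary d V" "\<Phi> = (\<lambda>v. V *\<^sub>v v) ` \<Psi>"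
      and W: "unitary d W" "\<Psi> = (\<lambda>v. W *\<^sub>v v) ` \<Theta>"
      by (auto simp: frame_equiv_def)
    have "V *\<^sub>v (W *\<^sub>v v) = (V * W) *\<^sub>v v" if "v \<in> \<Theta>" for v
      using that harmonic_frame_carrier[OF P(2)] V(1) W(1)
      by (intro assoc_mult_mat_vec[symmetric]) (auto simp: unitary_def)
    then have "\<Phi> = (\<lambda>v. (V * W) *\<^sub>v v) ` \<Theta>"
      unfolding V(2) W(2) image_image by simp
    then show "(\<Phi>, \<Theta>) \<in> frame_equiv N d"
      using P unitary_mult[OF V(1) W(1)] by (auto simp: frame_equiv_def)
  qed
qed

section \<open>The numbers \<open>\<alpha>\<^sub>c\<close>\<close>

text \<open>
  The two recursions for \<open>c > 1\<close> are the same formula in \<open>e\<close>, with \<open>e = d\<close> if \<open>c\<close> divides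
  \<open>d\<close> and \<open>e = d - 1\<close> if \<open>c\<close> divides \<open>d - 1\<close>; every \<open>b\<close> in the sum divides the same \<open>e\<close>.
\<close>

function alpha_rec :: "nat \<Rightarrow> nat \<Rightarrow> nat \<Rightarrow> real" where
  "alpha_rec N e c =
     (\<Prod>k = 1..<e div c. (real N - 1 - real k * real c)) / (real c ^ (e div c - 1) * fact (e div c))
     - real c / (real N - 1) *
       (\<Sum>b | c < b \<and> b < N \<and> c dvd b \<and> b dvd e \<and> b dvd N - 1.
          (real N - 1) / real b * alpha_rec N e b)"
  by auto
termination
  by (relation "measure (\<lambda>(N, e, c). N - c)") auto

declare alpha_rec.simps [simp del]

text \<open>
  Only the values at \<open>c\<close> with \<open>c dvd N - 1\<close> and \<open>c dvd d \<or> c dvd d - 1\<close> are meaningful. The two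
  cases for \<open>c > 1\<close> exclude each other because \<open>d\<close> and \<open>d - 1\<close> are coprime.
\<close>

definition alpha :: "nat \<Rightarrow> nat \<Rightarrow> nat \<Rightarrow> real" where
  "alpha N d c =
     (if c = 1 then
        1 / (real N - 1) * real (N choose d)
        - (\<Sum>b | b dvd d \<and> b dvd N - 1 \<and> b > 1. alpha_rec N d b / real b)
        - (\<Sum>b | b dvd d - 1 \<and> b dvd N - 1 \<and> b > 1. alpha_rec N (d - 1) b / real b)
      else if c dvd d then alpha_rec N d c
      else alpha_rec N (d - 1) c)"

end

theory Submission
  imports Defs "HOL-Number_Theory.Residue_Primitive_Roots"
begin

text \<open>
  A group of prime order is cyclic, so evaluating its characters at a generator identifies a set of
  \<open>d\<close> characters with a set \<open>S\<close> of \<open>d\<close> \<open>N\<close>-th roots of unity. The inner products of the frame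
  vectors are the sums of the \<open>u\<close>-th powers of the elements of \<open>S\<close>, and irreducibility of the
  \<open>N\<close>-th cyclotomic polynomial recovers a set of \<open>d\<close> roots from its sum. Hence two frames are
  equivalent iff their sets of roots differ by a power map \<open>z \<mapsto> z\<^sup>u\<close> with \<open>u\<close> prime to \<open>N\<close>.

  A primitive root modulo \<open>N\<close> turns the power maps on the \<open>n = N - 1\<close> nontrivial roots into the
  rotations of an \<open>n\<close>-cycle, while the root \<open>1\<close> is fixed. So the classes are the rotation orbits of
  the \<open>d\<close>-subsets (\<open>1 \<notin> S\<close>) and of the \<open>(d - 1)\<close>-subsets (\<open>1 \<in> S\<close>) of the cycle. The
  recursion for \<open>\<alpha>\<^sub>c\<close> is the inversion of the identity which counts the subsets fixed by the
  rotation by \<open>n / c\<close> according to their exact stabilizers.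
\<close>

section \<open>Sums of roots of unity of prime order\<close>

text \<open>Eisenstein's criterion, stated as a bound on the degree of integer polynomials vanishing
  at the root \<open>\<alpha>\<close>. A primitive polynomial \<open>m\<close> of least degree
  vanishing there divides \<open>E\<close>, say \<open>E = m * q'\<close>. Since
  \<open>r ^ 2\<close> does not divide the constant term of \<open>E\<close>, exactly one factor has
  its constant term divisible by \<open>r\<close>, and that factor has full degree. If it is
  \<open>q'\<close>, then \<open>m\<close> is a nonzero constant and cannot vanish at
  \<open>\<alpha>\<close>.\<close>

lemma eisenstein_degree:
  fixes E p :: "int poly" and \<alpha> :: complex and r :: int
  assumes r: "prime r" and lead: "\<not> r dvd lead_coeff E"
    and low: "\<And>i. i < degree E \<Longrightarrow> r dvd coeff E i" and E0: "\<not> r ^ 2 dvd coeff E 0"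
    and root: "poly (of_int_poly E) \<alpha> = 0"
    and p: "p \<noteq> 0" "poly (of_int_poly p) \<alpha> = 0"
  shows "degree E \<le> degree p"
proof -
  define Q where "Q = (\<lambda>p :: int poly. p \<noteq> 0 \<and> poly (of_int_poly p) \<alpha> = 0)"
  obtain m0 where m0: "Q m0" and min0: "\<And>q. Q q \<Longrightarrow> degree m0 \<le> degree q"
    using p ex_has_least_nat[of Q p degree] by (auto simp: Q_def)
  \<comment> \<open>By pseudo-division and Gauss's lemma, \<open>m\<close> divides \<open>E\<close> over the integers.\<close>
  define m where "m = primitive_part m0"
  have m0_eq: "m0 = smult (content m0) m"
    by (simp add: m_def)
  have m: "Q m"
  proof -
    have "content m0 \<noteq> 0" using m0 by (simp add: Q_def)
    moreover have "poly (of_int_poly m0) \<alpha> = of_int (content m0) * poly (of_int_poly m) \<alpha>"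
      by (subst m0_eq) (simp add: of_int_hom.map_poly_hom_smult)
    ultimately show ?thesis using m0 unfolding Q_def m_def by auto
  qed
  have min: "degree m \<le> degree q" if "Q q" for q
    using min0[OF that] by (simp add: m_def)
  have cm: "content m = 1" using m0 by (simp add: m_def Q_def)
  obtain a q where aq: "a \<noteq> 0" "smult a E = m * q + pseudo_mod E m"
    and r0: "pseudo_mod E m = 0 \<or> degree (pseudo_mod E m) < degree m"
    using pseudo_mod[of m E] m by (auto simp: Q_def)
  have "poly (of_int_poly (smult a E)) \<alpha> = 0"
    using root by (simp add: of_int_hom.map_poly_hom_smult)
  then have "poly (of_int_poly (pseudo_mod E m)) \<alpha> = 0"
    unfolding aq(2) using m by (simp add: Q_def of_int_poly_hom.hom_add of_int_poly_hom.hom_mult)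
  then have rem: "pseudo_mod E m = 0"
    using min[of "pseudo_mod E m"] r0 unfolding Q_def by linarith
  have "content (smult a E) = content q"
    using aq(2) rem cm by (simp add: content_mult)
  then have "a dvd content q" by (metis content_smult dvd_mult2 normalize_dvd_iff dvd_refl dvd_triv_left)
  then obtain q' where q': "q = smult a q'"
    by (metis const_poly_dvd_iff_dvd_content dvdE mult_pCons_left mult_zero_left pCons_0_0 add.right_neutral)
  have fac: "E = m * q'"
  proof -
    have "smult a E = smult a (m * q')" using aq(2) rem q' by simp
    then show ?thesis using aq(1) by (metis smult_cancel)
  qed
  \<comment> \<open>At the first index where the coefficient of \<open>f\<close> is not divisible by
    \<open>r\<close>, the coefficient of \<open>E\<close> is not divisible by \<open>r\<close>
    either. By \<open>low\<close> this index is at least \<open>degree E\<close>, and it is at most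
    \<open>degree f\<close>.\<close>
  have key: "degree E \<le> degree f"
    if fg: "E = f * g" and f0: "r dvd coeff f 0" and g0: "\<not> r dvd coeff g 0" for f g :: "int poly"
  proof -
    have "\<not> r dvd lead_coeff f"
      using lead unfolding fg lead_coeff_mult by auto
    then have ex: "\<exists>i. \<not> r dvd coeff f i" by blast
    define i where "i = (LEAST i. \<not> r dvd coeff f i)"
    have i: "\<not> r dvd coeff f i" using LeastI_ex[OF ex] by (simp add: i_def)
    have il: "r dvd coeff f k" if "k < i" for k using not_less_Least[of k] that by (auto simp: i_def)
    have "coeff E i = (\<Sum>k<i. coeff f k * coeff g (i - k)) + coeff f i * coeff g 0"
      unfolding fg coeff_mult by (simp add: lessThan_Suc_atMost[symmetric])
    moreover have "r dvd (\<Sum>k<i. coeff f k * coeff g (i - k))"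
      using il by (intro dvd_sum) auto
    moreover have "\<not> r dvd coeff f i * coeff g 0"
      using i g0 r by (simp add: prime_dvd_mult_iff)
    ultimately have "\<not> r dvd coeff E i" by (simp add: dvd_add_right_iff)
    then have "degree E \<le> i" using low[of i] by (meson not_le)
    moreover have "i \<le> degree f" using i by (metis dvd_0_right le_degree)
    ultimately show ?thesis by simp
  qed
  have E00: "coeff E 0 = coeff m 0 * coeff q' 0" using fac by (simp add: coeff_mult_0)
  have nn: "E \<noteq> 0" using lead by auto
  then have dE: "degree E = degree m + degree q'"
    using fac by (simp add: degree_mult_eq)
  have "degree E \<le> degree m"
  proof (cases "degree E = 0")
    case False
    then have "r dvd coeff m 0 * coeff q' 0" using low[of 0] E00 by simp
    then consider "r dvd coeff m 0" "\<not> r dvd coeff q' 0" | "r dvd coeff q' 0" "\<not> r dvd coeff m 0"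
      using E0 E00 r by (metis mult_dvd_mono power2_eq_square prime_dvd_multD)
    then show ?thesis
    proof cases
      case 1 then show ?thesis using key[OF fac] by simp
    next
      case 2
      have "degree E \<le> degree q'" using key[of q' m] fac 2 by (simp add: mult.commute)
      then have "degree m = 0" using dE by simp
      then obtain b where "m = [:b:]" by (metis degree_eq_zeroE)
      then have False using m by (cases "b = 0") (auto simp: Q_def)
      then show ?thesis ..
    qed
  qed simp
  then show ?thesis using min[of p] p by (simp add: Q_def)
qed

text \<open>The polynomial \<open>((X + 1) ^ N - 1) / X\<close> satisfies Eisenstein's criterion at
  \<open>N\<close> and vanishes at \<open>\<zeta> - 1\<close>. Substituting \<open>X + 1\<close>
  into \<open>p\<close> keeps its degree and moves its root to the same point.\<close>

lemma prime_root_of_unity_degree: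
  fixes p :: "int poly" and \<zeta> :: complex
  assumes N: "prime N" and z: "\<zeta> ^ N = 1" "\<zeta> \<noteq> 1"
    and p: "p \<noteq> 0" "poly (of_int_poly p) \<zeta> = 0"
  shows "N - 1 \<le> degree p"
proof -
  define E :: "int poly" where "E = (\<Sum>i<N. monom (int (N choose Suc i)) i)"
  have cE: "coeff E i = (if i < N then int (N choose Suc i) else 0)" for i
    by (simp add: E_def coeff_sum)
  have N2: "N \<ge> 2" using N prime_ge_2_nat by blast
  have dE: "degree E = N - 1"
    using N2 by (intro antisym degree_le le_degree) (auto simp: cE)
  \<comment> \<open>The product is the binomial expansion of \<open>((\<zeta> - 1) + 1) ^ N\<close>
    without its initial term 1, so it equals \<open>\<zeta> ^ N - 1 = 0\<close>.\<close>
  have "poly (of_int_poly E) (\<zeta> - 1) * (\<zeta> - 1) = (\<Sum>i<N. of_nat (N choose Suc i) * (\<zeta> - 1) ^ Suc i)"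
    by (simp add: E_def of_int_poly_hom.hom_sum poly_sum poly_monom sum_distrib_left mult_ac)
  also have "1 + \<dots> = (\<Sum>i<Suc N. of_nat (N choose i) * (\<zeta> - 1) ^ i)"
    by (subst sum.lessThan_Suc_shift) simp
  also have "\<dots> = ((\<zeta> - 1) + 1) ^ N"
    by (subst binomial_ring) (simp add: lessThan_Suc_atMost)
  finally have root: "poly (of_int_poly E) (\<zeta> - 1) = 0"
    using z by simp
  have "degree E \<le> degree (pcompose p [:1, 1:])"
  proof (rule eisenstein_degree[where r = "int N" and \<alpha> = "\<zeta> - 1"])
    show "prime (int N)" using N by simp
    show "\<not> int N dvd lead_coeff E" using N2 by (simp add: dE cE)
    show "int N dvd coeff E i" if "i < degree E" for i
      using that N by (auto simp: dE cE intro!: dvd_choose_prime)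
    show "\<not> (int N)\<^sup>2 dvd coeff E 0"
      using N2 by (auto simp: cE power2_eq_square dest: zdvd_imp_le)
    show "poly (of_int_poly (pcompose p [:1, 1:])) (\<zeta> - 1) = 0"
      using p by (simp add: of_int_hom.map_poly_pcompose poly_pcompose)
    show "pcompose p [:1, 1:] \<noteq> 0" using p(1) pcompose_eq_0[of p "[:1,1:]"] by auto
  qed (fact root)
  then show ?thesis by (simp add: dE)
qed

lemma roots_of_unity_generator:
  fixes n :: nat
  assumes "n > 0"
  obtains \<zeta> :: complex where "bij_betw (\<lambda>k. \<zeta> ^ k) {..<n} {z. z ^ n = 1}"
proof
  have "cis (2 * pi * real k / real n) = cis (2 * pi / real n) ^ k" for k
    by (simp add: DeMoivre mult_ac)
  then show "bij_betw (\<lambda>k. cis (2 * pi / real n) ^ k) {..<n} {z. z ^ n = 1}"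
    using bij_betw_roots_unity[OF assms] by simp
qed

text \<open>The difference of the two indicator functions, read along the exponents of a generator
  \<open>\<zeta>\<close>, is the coefficient sequence of an integer polynomial of degree below
  \<open>N\<close>. Equal sums make it vanish at \<open>\<zeta>\<close>, equal cardinalities make it
  vanish at 1. Together these are more zeros than a nonzero polynomial of this degree can
  have.\<close>

lemma sum_roots_of_unity_inj:
  fixes N :: nat and S S' :: "complex set"
  assumes N: "prime N" and S: "S \<subseteq> {z. z ^ N = 1}" "S' \<subseteq> {z. z ^ N = 1}"
    and card: "card S = card S'" and sum: "\<Sum>S = \<Sum>S'"
  shows "S = S'"
proof -
  have N2: "N \<ge> 2" using N prime_ge_2_nat by blast
  obtain \<zeta> :: complex where "bij_betw (\<lambda>k. \<zeta> ^ k) {..<N} {z. z ^ N = 1}"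
    using roots_of_unity_generator[of N] N2 by auto
  moreover define f where "f = (\<lambda>k. \<zeta> ^ k)"
  ultimately have bij: "bij_betw f {..<N} {z. z ^ N = 1}" by simp
  have fin: "finite S" "finite S'"
    using S finite_subset[OF _ finite_roots_unity] N2 by (metis (no_types) One_nat_def not_less_eq_eq numeral_2_eq_2 Suc_leD)+
  have z: "\<zeta> ^ N = 1" "\<zeta> \<noteq> 1"
  proof -
    show "\<zeta> ^ N = 1" using bij_betwE[OF bij, rule_format, of 1] N2 by (simp add: f_def)
    have "f 0 \<noteq> f 1" using bij N2 unfolding bij_betw_def inj_on_def by force
    then show "\<zeta> \<noteq> 1" by (simp add: f_def)
  qed
  define c where "c = (\<lambda>k. of_bool (f k \<in> S) - of_bool (f k \<in> S') :: int)"
  have tr: "(\<Sum>k<N. of_bool (f k \<in> A) * h (f k)) = (\<Sum>x\<in>A. h x)"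
    if "A \<subseteq> {z. z ^ N = 1}" for A and h :: "complex \<Rightarrow> complex"
  proof -
    have "(\<Sum>k<N. of_bool (f k \<in> A) * h (f k)) = (\<Sum>z | z ^ N = 1. of_bool (z \<in> A) * h z)"
      using sum.reindex_bij_betw[OF bij, of "\<lambda>z. of_bool (z \<in> A) * h z"] .
    also have "\<dots> = (\<Sum>x\<in>A. h x)"
      using that N2 by (intro sum.mono_neutral_cong_right finite_roots_unity) auto
    finally show ?thesis .
  qed
  define p where "p = (\<Sum>k<N. monom (c k) k)"
  have cp: "coeff p k = (if k < N then c k else 0)" for k
    by (simp add: p_def coeff_sum)
  have ev: "poly (of_int_poly p) w = (\<Sum>k<N. of_int (c k) * w ^ k)" for w :: complex
    by (simp add: p_def of_int_poly_hom.hom_sum poly_sum poly_monom)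
  have pz: "poly (of_int_poly p) \<zeta> = 0"
    using tr[OF S(1), of id] tr[OF S(2), of id] sum
    by (simp add: ev c_def left_diff_distrib sum_subtractf flip: f_def)
  have "(\<Sum>k<N. of_int (c k)) = (0 :: complex)"
    using tr[OF S(1), of "\<lambda>_. 1"] tr[OF S(2), of "\<lambda>_. 1"] card fin
    by (simp add: c_def sum_subtractf)
  then have "(\<Sum>k<N. c k) = 0"
    by (metis of_int_eq_0_iff of_int_sum)
  then have "poly p 1 = 0"
    by (simp add: p_def poly_sum poly_monom)
  \<comment> \<open>Splitting off the root 1 is what gives the contradiction: a nonzero
    \<open>q\<close> would have degree at most \<open>N - 2\<close> and still vanish at
    \<open>\<zeta>\<close>.\<close>
  then obtain q where q: "p = [:-1, 1:] * q"
    by (auto simp: poly_eq_0_iff_dvd)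
  have "q = 0"
  proof (rule ccontr)
    assume nz: "q \<noteq> 0"
    have "(\<zeta> - 1) * poly (of_int_poly q) \<zeta> = 0"
      using pz unfolding q of_int_poly_hom.hom_mult poly_mult by (simp)
    then have "N - 1 \<le> degree q"
      using prime_root_of_unity_degree[OF N z nz] z by simp
    moreover have "degree p = Suc (degree q)" unfolding q using nz by (subst degree_mult_eq) auto
    moreover have "degree p \<le> N - 1" by (intro degree_le) (auto simp: cp)
    ultimately show False using N2 by simp
  qed
  then have "c k = 0" if "k < N" for k using q cp[of k] that by simp
  then have "f k \<in> S \<longleftrightarrow> f k \<in> S'" if "k < N" for k
    using that by (force simp: c_def of_bool_def split: if_splits)
  then show ?thesis
    using S bij unfolding bij_betw_def by (auto simp: set_eq_iff image_iff subset_iff) (metis lessThan_iff)+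
qed

section \<open>Orbits of a cyclic action\<close>

definition period :: "('a \<Rightarrow> 'a) \<Rightarrow> 'a \<Rightarrow> nat" where
  "period T x = (LEAST p. p > 0 \<and> (T ^^ p) x = x)"

text \<open>An action of the integers modulo \<open>n\<close> through the powers of
  \<open>T\<close>: the last assumption makes \<open>T\<close> invertible on
  \<open>S\<close>.\<close>

locale cyclic_action =
  fixes S :: "'a set" and T :: "'a \<Rightarrow> 'a" and n :: nat
  assumes fin: "finite S" and n: "n > 0"
    and T: "x \<in> S \<Longrightarrow> T x \<in> S" and Tn: "x \<in> S \<Longrightarrow> (T ^^ n) x = x"
begin

text \<open>Nonnegative powers suffice for an equivalence relation, because
  \<open>T ^^ (n * i - i)\<close> is inverse to \<open>T ^^ i\<close> on \<open>S\<close>.\<close>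

definition orbit_rel :: "'a rel" where
  "orbit_rel = {(x, y). x \<in> S \<and> (\<exists>i. y = (T ^^ i) x)}"

lemma funpow_in: "x \<in> S \<Longrightarrow> (T ^^ i) x \<in> S"
  by (induction i) (auto intro: T)

lemma funpow_mult_fix: "x \<in> S \<Longrightarrow> (T ^^ p) x = x \<Longrightarrow> (T ^^ (p * k)) x = x"
  by (induction k) (auto simp: funpow_add)

lemma period: assumes "x \<in> S" shows "period T x > 0" "(T ^^ period T x) x = x"
  using LeastI[of "\<lambda>p. p > 0 \<and> (T ^^ p) x = x" n] n Tn[OF assms]
  by (auto simp: period_def)

lemma fix_iff: assumes x: "x \<in> S" shows "(T ^^ i) x = x \<longleftrightarrow> period T x dvd i"
proof
  assume i: "(T ^^ i) x = x"
  let ?p = "period T x"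
  have "(T ^^ (i mod ?p + ?p * (i div ?p))) x = (T ^^ (i mod ?p)) x"
    unfolding funpow_add o_def using funpow_mult_fix[OF x period(2)[OF x]] by simp
  \<comment> \<open>The remainder of \<open>i\<close> also fixes \<open>x\<close> but is smaller
    than the least positive such exponent, so it is 0.\<close>
  then have r: "(T ^^ (i mod ?p)) x = x" using i by simp
  have "i mod ?p < ?p" using period(1)[OF x] by simp
  then have "i mod ?p = 0"
    using r not_less_Least[of "i mod ?p" "\<lambda>p. p > 0 \<and> (T ^^ p) x = x"]
    by (auto simp: period_def)
  then show "?p dvd i" by auto
qed (use funpow_mult_fix[OF x period(2)[OF x]] in auto)

lemma period_dvd: "x \<in> S \<Longrightarrow> period T x dvd n"
  using fix_iff Tn by blast

lemma funpow_eq_iff: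
  assumes x: "x \<in> S" and "i \<le> j"
  shows "(T ^^ i) x = (T ^^ j) x \<longleftrightarrow> period T x dvd j - i"
proof
  assume e: "(T ^^ i) x = (T ^^ j) x"
  have ni: "i \<le> n * i" using n by simp
  \<comment> \<open>Cancelling \<open>T ^^ i\<close>: a further \<open>n * i - i\<close> steps
    complete \<open>n * i\<close> steps, which act as the identity. The multiple
    \<open>n * i\<close> is at least \<open>i\<close>, so the subtraction is not truncated.\<close>
  have "(T ^^ (n * i - i)) ((T ^^ i) x) = (T ^^ (n * i - i)) ((T ^^ j) x)" using e by simp
  then have "(T ^^ (n * i - i + i)) x = (T ^^ (n * i - i + j)) x"
    by (simp only: funpow_add o_def)
  moreover have "n * i - i + i = n * i" "n * i - i + j = n * i + (j - i)" using ni \<open>i \<le> j\<close> by auto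
  ultimately have "(T ^^ (n * i + (j - i))) x = x" using funpow_mult_fix[OF x Tn[OF x]] by metis
  then have "period T x dvd n * i + (j - i)" using fix_iff[OF x] by blast
  then show "period T x dvd j - i"
    using period_dvd[OF x] by (metis dvd_add_right_iff dvd_mult2)
next
  assume "period T x dvd j - i"
  then have "(T ^^ (j - i)) x = x" using fix_iff[OF x] by blast
  then have "(T ^^ (i + (j - i))) x = (T ^^ i) x" by (simp only: funpow_add o_def)
  then show "(T ^^ i) x = (T ^^ j) x" using \<open>i \<le> j\<close> by simp
qed

lemma orbit_eq:
  assumes x: "x \<in> S" shows "orbit_rel `` {x} = (\<lambda>i. (T ^^ i) x) ` {..<period T x}"
proof -
  have "(T ^^ i) x \<in> (\<lambda>i. (T ^^ i) x) ` {..<period T x}" for i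
  proof
    show "(T ^^ i) x = (T ^^ (i mod period T x)) x"
      using funpow_eq_iff[OF x, of "i mod period T x" i] by (simp add: dvd_minus_mod)
  qed (use period(1)[OF x] in auto)
  then show ?thesis using x by (auto simp: orbit_rel_def)
qed

lemma card_orbit: assumes x: "x \<in> S" shows "card (orbit_rel `` {x}) = period T x"
proof -
  have "inj_on (\<lambda>i. (T ^^ i) x) {..<period T x}"
  proof (rule linorder_inj_onI)
    fix i j assume "i < j" "i \<in> {..<period T x}" "j \<in> {..<period T x}"
    then have "\<not> period T x dvd j - i" by (auto dest: dvd_imp_le)
    then show "(T ^^ i) x \<noteq> (T ^^ j) x" using funpow_eq_iff[OF x] \<open>i < j\<close> by simp
  qed auto
  then show ?thesis by (simp add: orbit_eq[OF x] card_image)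
qed

lemma equiv_orbit_rel: "equiv S orbit_rel"
proof (rule equivI)
  show "refl_on S orbit_rel" by (intro refl_onI) (auto simp: orbit_rel_def intro: exI[of _ 0])
  show "sym orbit_rel"
  proof (rule symI)
    fix x y assume "(x, y) \<in> orbit_rel"
    then obtain i where x: "x \<in> S" and y: "y = (T ^^ i) x" by (auto simp: orbit_rel_def)
    have "(T ^^ (n * i - i + i)) x = x" using n funpow_mult_fix[OF x Tn[OF x], of i] by simp
    then have "x = (T ^^ (n * i - i)) y" by (simp add: funpow_add y)
    then show "(y, x) \<in> orbit_rel" using x by (auto simp: orbit_rel_def y funpow_in)
  qed
  show "trans orbit_rel"
    by (rule transI) (auto simp: orbit_rel_def, metis funpow_add o_apply)
qed (auto simp: orbit_rel_def funpow_in)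

text \<open>By \<open>funpow_eq_iff\<close> with exponents \<open>i\<close> and
  \<open>i + j\<close>, every point of an orbit returns after the same numbers of steps
  \<open>j\<close>.\<close>

lemma period_funpow: assumes x: "x \<in> S" shows "period T ((T ^^ i) x) = period T x"
proof -
  have "period T ((T ^^ i) x) dvd j \<longleftrightarrow> period T x dvd j" for j
  proof -
    have "(T ^^ j) ((T ^^ i) x) = (T ^^ (i + j)) x"
      by (simp add: add.commute[of i] funpow_add)
    then show ?thesis
      using fix_iff[OF funpow_in[OF x], of j i] funpow_eq_iff[OF x, of i "i + j"] by auto
  qed
  then show ?thesis by (metis dvd_antisym dvd_refl)
qed

definition orbits_of_period :: "nat \<Rightarrow> 'a set set" where
  "orbits_of_period p = (\<lambda>x. orbit_rel `` {x}) ` {x \<in> S. period T x = p}"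

lemma period_orbit: "y \<in> orbit_rel `` {x} \<Longrightarrow> period T y = period T x \<and> y \<in> S"
  by (auto simp: orbit_rel_def period_funpow funpow_in)

lemma self_in_orbit: "x \<in> S \<Longrightarrow> x \<in> orbit_rel `` {x}"
  by (auto simp: orbit_rel_def intro: exI[of _ 0])

text \<open>The points of period \<open>p\<close> are a disjoint union of orbits, each having
  \<open>p\<close> elements.\<close>

lemma card_period: "card {x \<in> S. period T x = p} = p * card (orbits_of_period p)"
proof -
  have U: "\<Union>(orbits_of_period p) = {x \<in> S. period T x = p}"
    using period_orbit self_in_orbit by (fastforce simp: orbits_of_period_def)
  have "p * card (orbits_of_period p) = card (\<Union>(orbits_of_period p))"
  proof (rule card_partition)
    show "c1 \<inter> c2 = {}" if "c1 \<in> orbits_of_period p" "c2 \<in> orbits_of_period p" "c1 \<noteq> c2" for c1 c2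
      using that quotient_disj[OF equiv_orbit_rel, of c1 c2]
      by (auto simp: orbits_of_period_def intro: quotientI)
    show "card c = p" if "c \<in> orbits_of_period p" for c
      using that by (auto simp: orbits_of_period_def card_orbit)
  qed (use fin in \<open>auto simp: U orbits_of_period_def orbit_eq\<close>)
  then show ?thesis by (simp add: U)
qed

lemma card_quotient: "card (S // orbit_rel) = (\<Sum>p | p dvd n. card (orbits_of_period p))"
proof -
  have "S // orbit_rel = (\<Union>p\<in>{p. p dvd n}. orbits_of_period p)"
    using period_dvd by (auto simp: quotient_def orbits_of_period_def)
  moreover have "orbits_of_period p \<inter> orbits_of_period q = {}" if "p \<noteq> q" for p q
  proof (rule ccontr)
    assume "orbits_of_period p \<inter> orbits_of_period q \<noteq> {}"
    then obtain x y where "x \<in> S" "period T x = p" "period T y = q" "orbit_rel `` {x} = orbit_rel `` {y}"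
      by (auto simp: orbits_of_period_def)
    then show False using period_orbit[of x y] self_in_orbit that by auto
  qed
  moreover have "finite (orbits_of_period p)" for p
    using fin by (simp add: orbits_of_period_def)
  ultimately show ?thesis
    using n by (simp add: card_UN_disjoint)
qed

text \<open>By \<open>fix_iff\<close> the points fixed by \<open>T ^^ q\<close> are sorted by their
  period, which runs through the divisors of \<open>q\<close>.\<close>

lemma card_fix:
  assumes q: "q > 0"
  shows "card {x \<in> S. (T ^^ q) x = x} = (\<Sum>p | p dvd q. card {x \<in> S. period T x = p})"
proof -
  have "{x \<in> S. (T ^^ q) x = x} = (\<Union>p\<in>{p. p dvd q}. {x \<in> S. period T x = p})"
    by (auto simp: fix_iff)
  then show ?thesis using q fin by (auto intro!: card_UN_disjoint)
qed

end

section \<open>Rotations of subsets of a cycle\<close>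

definition rotate_subset :: "nat \<Rightarrow> nat set \<Rightarrow> nat set" where
  "rotate_subset n A = (\<lambda>a. (a + 1) mod n) ` A"

definition ksubsets :: "'a set \<Rightarrow> nat \<Rightarrow> 'a set set" where
  "ksubsets Z e = {A. A \<subseteq> Z \<and> card A = e}"

lemma funpow_image:
  fixes f :: "'a \<Rightarrow> 'a"
  shows "((`) f ^^ i) A = (f ^^ i) ` A"
  by (induction i) (auto simp: image_comp)

lemma funpow_rot: "a < n \<Longrightarrow> ((\<lambda>a. (a + 1) mod n) ^^ i) a = (a + i) mod n"
  by (induction i) (auto simp: mod_Suc_eq)

lemma funpow_rotate_subset: "A \<subseteq> {..<n} \<Longrightarrow> (rotate_subset n ^^ i) A = (\<lambda>a. (a + i) mod n) ` A"
  unfolding rotate_subset_def[abs_def] funpow_image by (intro image_cong refl funpow_rot) auto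

lemma inj_on_rot: fixes n i :: nat shows "inj_on (\<lambda>a. (a + i) mod n) {..<n}"
proof (rule linorder_inj_onI)
  fix a b assume ab: "a < b" "a \<in> {..<n}" "b \<in> {..<n}"
  show "(a + i) mod n \<noteq> (b + i) mod n"
  proof
    assume "(a + i) mod n = (b + i) mod n"
    then have "n dvd b + i - (a + i)" using ab by (metis mod_eq_dvd_iff_nat add_le_mono1 less_imp_le_nat)
    then show False using ab by (auto dest: dvd_imp_le)
  qed
qed auto

lemma cyclic_action_rotate_subset:
  assumes "n > 0" shows "cyclic_action (ksubsets {..<n} e) (rotate_subset n) n"
proof
  show "finite (ksubsets {..<n} e)" by (simp add: ksubsets_def)
  fix A assume "A \<in> ksubsets {..<n} e"
  then have A: "A \<subseteq> {..<n}" "card A = e" by (auto simp: ksubsets_def)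
  show "rotate_subset n A \<in> ksubsets {..<n} e"
    using A assms inj_on_subset[OF inj_on_rot[of 1 n] A(1)]
    by (auto simp: ksubsets_def rotate_subset_def card_image)
  show "(rotate_subset n ^^ n) A = A"
    using A by (force simp: funpow_rotate_subset)
qed fact

text \<open>Division with remainder: \<open>a = b + p * k\<close> with the residue \<open>b\<close>
  in \<open>B\<close> and the quotient \<open>k < c\<close> free.\<close>

lemma card_residue_preimage:
  assumes n: "n = p * c" "p > 0" and B: "B \<subseteq> {..<p}"
  shows "card {a. a < n \<and> a mod p \<in> B} = c * card B"
proof -
  have "bij_betw (\<lambda>(b, k). b + p * k) (B \<times> {..<c}) {a. a < n \<and> a mod p \<in> B}"
  proof (rule bij_betwI[where g = "\<lambda>a. (a mod p, a div p)"])
    show "(\<lambda>(b, k). b + p * k) \<in> B \<times> {..<c} \<rightarrow> {a. a < n \<and> a mod p \<in> B}"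
    proof (rule funcsetI)
      fix x assume "x \<in> B \<times> {..<c}"
      then obtain b k where x: "x = (b, k)" and "b \<in> B" "k < c" by auto
      have "b < p" using B \<open>b \<in> B\<close> by auto
      then have "b + p * k < p * Suc k" by simp
      also have "\<dots> \<le> n" using \<open>k < c\<close> unfolding n(1) by (intro mult_le_mono2) simp
      finally show "(case x of (b, k) \<Rightarrow> b + p * k) \<in> {a. a < n \<and> a mod p \<in> B}"
        using \<open>b \<in> B\<close> \<open>b < p\<close> by (simp add: x)
    qed
    show "(\<lambda>a. (a mod p, a div p)) \<in> {a. a < n \<and> a mod p \<in> B} \<rightarrow> B \<times> {..<c}"
      by (auto simp: n less_mult_imp_div_less mult.commute)
  qed (use B n in auto)
  from bij_betw_same_card[OF this] show ?thesis by (simp add: card_cartesian_product mult.commute)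
qed

lemma card_fix_rotate_subset:
  assumes n: "n = p * c" "n > 0"
  shows "card {A \<in> ksubsets {..<n} e. (rotate_subset n ^^ p) A = A} =
    (if c dvd e then p choose (e div c) else 0)"
proof -
  have pc: "p > 0" "c > 0" using n by auto
  \<comment> \<open>The sets fixed by the rotation by \<open>p\<close> are the preimages of sets of residues modulo \<open>p\<close>.\<close>
  define P where "P = (\<lambda>B. {a. a < n \<and> a mod p \<in> B})"
  have pn: "p \<le> n" using n pc by simp
  \<comment> \<open>As \<open>p\<close> divides \<open>n\<close>, adding \<open>p\<close> modulo
    \<open>n\<close> keeps residues modulo \<open>p\<close>, so \<open>P B\<close> is mapped into
    itself. Injectivity and finiteness give equality.\<close>
  have fixP: "(rotate_subset n ^^ p) (P B) = P B" if "B \<subseteq> {..<p}" for B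
  proof (rule card_subset_eq)
    show "finite (P B)" by (simp add: P_def)
    have "P B \<subseteq> {..<n}" by (auto simp: P_def)
    then show "(rotate_subset n ^^ p) (P B) \<subseteq> P B" "card ((rotate_subset n ^^ p) (P B)) = card (P B)"
      using n inj_on_subset[OF inj_on_rot[of p n]]
      by (auto simp: funpow_rotate_subset card_image P_def mod_mod_cancel)
  qed
  have inv: "\<exists>B\<subseteq>{..<p}. A = P B" if A: "A \<subseteq> {..<n}" and fx: "(rotate_subset n ^^ p) A = A" for A
  proof (intro exI conjI)
    have step: "(a + p) mod n \<in> A" if "a \<in> A" for a
      using fx that unfolding funpow_rotate_subset[OF A] by blast
    have steps: "(a + p * k) mod n \<in> A" if "a \<in> A" for a k
    proof (induction k)
      case 0 then show ?case using that A by auto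
    next
      case (Suc k)
      have "((a + p * k) mod n + p) mod n = (a + p * Suc k) mod n"
        by (subst mod_add_left_eq) (simp add: algebra_simps)
      then show ?case using step[OF Suc.IH] by simp
    qed
    show "{b. b < p \<and> b \<in> A} \<subseteq> {..<p}" by auto
    \<comment> \<open>Starting at \<open>a\<close>, another \<open>c - a div p\<close> steps of
      length \<open>p\<close> pass \<open>n\<close> exactly once and end at \<open>a mod p\<close>.
      Conversely, \<open>a div p\<close> steps lead from \<open>a mod p\<close> back to
      \<open>a\<close>.\<close>
    have up: "a \<in> A \<longleftrightarrow> a mod p \<in> A" if "a < n" for a
    proof
      assume "a \<in> A"
      have le: "a div p \<le> c" using that n pc by (metis less_imp_le_nat less_mult_imp_div_less mult.commute)
      have "a + p * (c - a div p) = a mod p + n"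
      proof -
        have "a + p * (c - a div p) = a mod p + (p * (a div p) + p * (c - a div p))" by simp
        also have "p * (a div p) + p * (c - a div p) = n"
          using le n by (metis add_mult_distrib2 le_add_diff_inverse)
        finally show ?thesis .
      qed
      moreover have "a mod p < n" using pc pn by (meson less_le_trans mod_less_divisor)
      ultimately show "a mod p \<in> A" using steps[OF \<open>a \<in> A\<close>, of "c - a div p"] by simp
    next
      assume "a mod p \<in> A"
      then show "a \<in> A" using steps[of "a mod p" "a div p"] that by simp
    qed
    show "A = P {b. b < p \<and> b \<in> A}"
      using up A pc by (auto simp: P_def)
  qed
  have cP: "card (P B) = c * card B" if "B \<subseteq> {..<p}" for B
    unfolding P_def using card_residue_preimage[OF n(1) pc(1) that] .
  have injP: "inj_on P (Pow {..<p})"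
  proof (rule inj_onI)
    fix B B' assume B: "B \<in> Pow {..<p}" "B' \<in> Pow {..<p}" and e: "P B = P B'"
    \<comment> \<open>Numbers below \<open>p\<close> are their own residues and lie below
      \<open>n\<close>, so \<open>B\<close> can be read off from the initial segment of
      \<open>P B\<close>.\<close>
    have "B = {b. b < p \<and> b \<in> P B}" if "B \<subseteq> {..<p}" for B
      using that pn by (auto simp: P_def)
    then show "B = B'" using B e by (metis PowD)
  qed
  have eq: "{A \<in> ksubsets {..<n} e. (rotate_subset n ^^ p) A = A} = P ` {B. B \<subseteq> {..<p} \<and> c * card B = e}"
    (is "?L = ?R")
  proof
    show "?L \<subseteq> ?R"
    proof
      fix A assume "A \<in> ?L"
      then have A: "A \<subseteq> {..<n}" "card A = e" "(rotate_subset n ^^ p) A = A" by (auto simp: ksubsets_def)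
      then obtain B where "B \<subseteq> {..<p}" "A = P B" using inv by blast
      then show "A \<in> ?R" using cP A by auto
    qed
    have "P B \<subseteq> {..<n}" for B by (auto simp: P_def)
    then show "?R \<subseteq> ?L" using fixP cP by (auto simp: ksubsets_def)
  qed
  have "card \<dots> = card {B. B \<subseteq> {..<p} \<and> c * card B = e}"
    by (intro card_image inj_on_subset[OF injP]) auto
  also have "\<dots> = (if c dvd e then p choose (e div c) else 0)"
  proof (cases "c dvd e")
    case True
    then have "{B. B \<subseteq> {..<p} \<and> c * card B = e} = {B. B \<subseteq> {..<p} \<and> card B = e div c}"
      using pc by auto
    then show ?thesis using True n_subsets[of "{..<p}" "e div c"] by simp
  next
    case False
    then have "{B. B \<subseteq> {..<p} \<and> c * card B = e} = {}" by auto
    then show ?thesis using False by simp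
  qed
  finally show ?thesis using eq by simp
qed

text \<open>
  The orbits of rotation period \<open>p\<close>, i.e. with stabilizer of order \<open>n / p\<close>; thus \<open>\<alpha>\<^sub>c\<close> belongs
  to \<open>p = n / c\<close>.
\<close>

definition necklaces :: "nat \<Rightarrow> nat \<Rightarrow> nat \<Rightarrow> nat" where
  "necklaces n e p = card (cyclic_action.orbits_of_period (ksubsets {..<n} e) (rotate_subset n) p)"

lemma card_period_rotate_subset:
  assumes "n > 0"
  shows "card {A \<in> ksubsets {..<n} e. period (rotate_subset n) A = p} = p * necklaces n e p"
  using cyclic_action.card_period[OF cyclic_action_rotate_subset[OF assms]] by (simp add: necklaces_def)

text \<open>A set of period \<open>n div b\<close> is fixed by the rotation by
  \<open>n div b\<close>. Such sets are unions of blocks of \<open>b\<close> elements, so none has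
  \<open>e\<close> elements unless \<open>b\<close> divides \<open>e\<close>.\<close>

lemma necklaces_eq_0:
  assumes "n > 0" "b dvd n" "\<not> b dvd e"
  shows "necklaces n e (n div b) = 0"
proof -
  interpret cyclic_action "ksubsets {..<n} e" "rotate_subset n" n
    using cyclic_action_rotate_subset assms by blast
  have nb: "n = n div b * b" "n div b > 0" using assms by (auto elim!: dvdE)
  have "{A \<in> ksubsets {..<n} e. period (rotate_subset n) A = n div b}
      \<subseteq> {A \<in> ksubsets {..<n} e. (rotate_subset n ^^ (n div b)) A = A}"
    by (rule Collect_mono) (simp add: fix_iff cong: conj_cong)
  then have "card {A \<in> ksubsets {..<n} e. period (rotate_subset n) A = n div b}
    \<le> card {A \<in> ksubsets {..<n} e. (rotate_subset n ^^ (n div b)) A = A}"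
    using fin by (intro card_mono) auto
  also have "\<dots> = 0" using card_fix_rotate_subset[OF nb(1) assms(1)] assms(3) by simp
  finally show ?thesis using nb(2) card_period_rotate_subset[OF assms(1)] by simp
qed

section \<open>Divisor sums and the inversion of the recursion\<close>

lemma div_div_self_dvd: "p dvd n \<Longrightarrow> n > 0 \<Longrightarrow> n div (n div p) = p" for n p :: nat
  by (metis dvd_div_eq_0_iff dvd_div_mult_self less_not_refl nonzero_mult_div_cancel_left)

lemma sum_dvd_div:
  fixes f :: "nat \<Rightarrow> 'b :: comm_monoid_add"
  assumes "n > 0" "c dvd n"
  shows "(\<Sum>p | p dvd n div c. f p) = (\<Sum>b | c dvd b \<and> b dvd n. f (n div b))"
proof (rule sum.reindex_bij_witness[of _ "\<lambda>b. n div b" "\<lambda>p. n div p"], goal_cases)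
  case (1 p)
  then have "p dvd n" by (metis assms(2) dvd_div_mult_self dvd_mult2 mem_Collect_eq)
  then show ?case using assms by (simp add: div_div_self_dvd)
next
  case (2 p)
  then show ?case using assms by (auto elim!: dvdE)
next
  case (3 b)
  then show ?case using assms by (simp add: div_div_self_dvd)
next
  case (4 b)
  then show ?case using assms by (auto elim!: dvdE)
next
  case (5 b)
  then have "b dvd n" by (metis assms(2) dvd_div_mult_self dvd_mult2 mem_Collect_eq)
  then show ?case using assms by (simp add: div_div_self_dvd)
qed

text \<open>Double count of the \<open>e\<close>-subsets fixed by the rotation by
  \<open>n div c\<close>. They correspond to sets of \<open>e div c\<close> residues. They are also
  sorted by their period \<open>n div b\<close>, where \<open>c dvd b\<close> and each of the orbits
  contributes \<open>n div b\<close> subsets. Terms with \<open>b\<close> not dividing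
  \<open>e\<close> vanish.\<close>

lemma binomial_necklaces:
  assumes n: "n > 0" and c: "c dvd n" "c dvd e"
  shows "(n div c) choose (e div c) =
    (\<Sum>b | c dvd b \<and> b dvd n \<and> b dvd e. (n div b) * necklaces n e (n div b))"
proof -
  interpret cyclic_action "ksubsets {..<n} e" "rotate_subset n" n
    using cyclic_action_rotate_subset n by blast
  have nc: "n = n div c * c" "n div c > 0" using n c by (auto elim!: dvdE)
  have "(n div c) choose (e div c) = (\<Sum>p | p dvd n div c. p * necklaces n e p)"
    using card_fix_rotate_subset[OF nc(1) n, of e] card_fix[OF nc(2)] c(2)
    by (simp add: card_period_rotate_subset[OF n])
  also have "\<dots> = (\<Sum>b | c dvd b \<and> b dvd n. (n div b) * necklaces n e (n div b))"
    using sum_dvd_div[OF n c(1)] .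
  also have "\<dots> = (\<Sum>b | c dvd b \<and> b dvd n \<and> b dvd e. (n div b) * necklaces n e (n div b))"
    using n necklaces_eq_0[OF n] by (intro sum.mono_neutral_right) auto
  finally show ?thesis .
qed

text \<open>This identifies the first term of the recursion for \<open>alpha_rec\<close>. In the
  falling product for the binomial coefficient, the factor \<open>n / c\<close> at
  \<open>k = 0\<close> is cancelled by the prefactor \<open>c / n\<close>; each of the other
  \<open>m - 1\<close> factors gives up one \<open>c\<close> to the denominator.\<close>

lemma binomial_leading_term:
  fixes n c m :: nat
  assumes "n > 0" "c dvd n" "m > 0"
  shows "(\<Prod>k = 1..<m. (real n - real k * real c)) / (real c ^ (m - 1) * fact m) =
    real c / real n * real (n div c choose m)"
proof -
  have c: "c > 0" using assms by (auto intro: Nat.gr0I)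
  have q: "real (n div c) = real n / real c" using assms by (simp add: real_of_nat_div)
  have "real (n div c choose m) = (\<Prod>k = 0..<m. real n / real c - real k) / fact m"
    by (simp add: binomial_gbinomial gbinomial_prod_rev q)
  also have "(\<Prod>k = 0..<m. real n / real c - real k) =
      real n / real c * (\<Prod>k = 1..<m. real n / real c - real k)"
    using assms(3) by (subst prod.atLeast_Suc_lessThan) auto
  also have "(\<Prod>k = 1..<m. real n / real c - real k) =
      (\<Prod>k = 1..<m. (real n - real k * real c) / real c)"
    using c by (intro prod.cong) (auto simp: field_simps)
  also have "\<dots> = (\<Prod>k = 1..<m. (real n - real k * real c)) / real c ^ (m - 1)"
    by (simp add: prod_dividef)
  finally show ?thesis using c assms(1) by (simp add: field_simps)
qed

text \<open>The recursion is \<open>binomial_necklaces\<close> solved for the summand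
  \<open>b = c\<close>. The summands with larger \<open>b\<close> are known by induction on
  \<open>n - c\<close>, that is, from the large divisors downwards.\<close>

lemma alpha_rec_eq_necklaces:
  assumes n: "n > 0" and e: "e > 0"
  shows "c dvd n \<Longrightarrow> c dvd e \<Longrightarrow> alpha_rec (Suc n) e c = real (necklaces n e (n div c))"
proof (induction "n - c" arbitrary: c rule: less_induct)
  case less
  let ?f = "\<lambda>b. real n / real b * real (necklaces n e (n div b))"
  let ?B = "{b. c < b \<and> b < Suc n \<and> c dvd b \<and> b dvd e \<and> b dvd n}"
  have c: "c > 0" "c < Suc n" using less n by (auto intro: Nat.gr0I dest: dvd_imp_le)
  have m: "e div c > 0" using less(3) e c by (simp add: dvd_imp_le div_greater_zero_iff)
  have IH: "alpha_rec (Suc n) e b = real (necklaces n e (n div b))" if "b \<in> ?B" for b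
    using that n by (intro less(1)) auto
  have "real (n div c choose (e div c)) = (\<Sum>b | c dvd b \<and> b dvd n \<and> b dvd e. ?f b)"
    unfolding binomial_necklaces[OF n less(2,3)] of_nat_sum
    by (intro sum.cong) (auto simp: real_of_nat_div)
  \<comment> \<open>The index set of the recursion, together with the unknown \<open>b = c\<close>.
    The bound \<open>b < Suc n\<close> holds for every divisor of \<open>n\<close>.\<close>
  also have "{b. c dvd b \<and> b dvd n \<and> b dvd e} = insert c ?B"
    (is "?A = _")
  proof
    show "?A \<subseteq> insert c ?B"
    proof
      fix b assume b: "b \<in> ?A"
      then have "b > 0" "b \<le> n" using n by (auto dest: dvd_imp_le intro: dvd_pos_nat)
      then show "b \<in> insert c ?B" using b dvd_imp_le[of c b] by auto
    qed
  qed (use less(2,3) in auto)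
  also have "sum ?f \<dots> = ?f c + sum ?f ?B"
    by (subst sum.insert) auto
  finally have bin: "real (n div c choose (e div c)) = ?f c + sum ?f ?B" .
  have "alpha_rec (Suc n) e c = real c / real n * real (n div c choose (e div c)) - real c / real n * sum ?f ?B"
    using binomial_leading_term[OF n less(2) m] IH
    by (subst alpha_rec.simps) simp
  also have "\<dots> = real c / real n * ?f c"
    unfolding bin by (simp add: algebra_simps)
  finally show ?case using c n by simp
qed

lemma sum_divisors_gt_1:
  fixes f :: "nat \<Rightarrow> 'b :: comm_monoid_add"
  assumes n: "n > 0" and z: "\<And>b. b dvd n \<Longrightarrow> \<not> b dvd e \<Longrightarrow> f b = 0"
  shows "(\<Sum>p | p dvd n. f (n div p)) = f 1 + (\<Sum>b | b dvd e \<and> b dvd n \<and> b > 1. f b)"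
proof -
  have "(\<Sum>p | p dvd n. f (n div p)) = (\<Sum>b | b dvd n. f (n div (n div b)))"
    using sum_dvd_div[OF n, of 1 "\<lambda>p. f (n div p)"] by simp
  also have "\<dots> = (\<Sum>b | b dvd n. f b)"
    using n by (intro sum.cong) (auto simp: div_div_self_dvd)
  also have "\<dots> = (\<Sum>b\<in>insert 1 {b. b dvd e \<and> b dvd n \<and> b > 1}. f b)"
    using n z by (intro sum.mono_neutral_right) (auto dest: dvd_pos_nat simp: Suc_lessI)
  also have "\<dots> = f 1 + (\<Sum>b | b dvd e \<and> b dvd n \<and> b > 1. f b)"
    using n by (subst sum.insert) auto
  finally show ?thesis .
qed

text \<open>Counts all orbits of \<open>e\<close>-subsets. Those with trivial stabilizer
  (\<open>p = n\<close>, \<open>b = 1\<close>) stay apart, since \<open>alpha\<close> has its own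
  clause at 1, in which the cases \<open>e = d\<close> and \<open>e = d - 1\<close> are
  merged.\<close>

lemma sum_alpha_rec:
  assumes n: "n > 0" and e: "e > 0"
  shows "real (\<Sum>p | p dvd n. necklaces n e p) =
    real (necklaces n e n) + (\<Sum>b | b dvd e \<and> b dvd n \<and> b > 1. alpha_rec (Suc n) e b)"
proof -
  have "real (\<Sum>p | p dvd n. necklaces n e p) = (\<Sum>p | p dvd n. real (necklaces n e (n div (n div p))))"
    unfolding of_nat_sum using n by (intro sum.cong) (auto simp: div_div_self_dvd)
  also have "\<dots> = real (necklaces n e (n div 1))
      + (\<Sum>b | b dvd e \<and> b dvd n \<and> b > 1. real (necklaces n e (n div b)))"
    by (rule sum_divisors_gt_1[OF n]) (simp add: necklaces_eq_0 n)
  finally show ?thesis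
    by (simp add: alpha_rec_eq_necklaces[OF n e])
qed

text \<open>The case \<open>c = 1\<close> of \<open>binomial_necklaces\<close>, divided by
  \<open>n\<close>: an orbit with stabilizer of order \<open>b\<close> has weight
  \<open>1 / b\<close>.\<close>

lemma binomial_alpha_rec:
  assumes n: "n > 0" and e: "e > 0"
  shows "real (n choose e) / real n =
    real (necklaces n e n) + (\<Sum>b | b dvd e \<and> b dvd n \<and> b > 1. alpha_rec (Suc n) e b / real b)"
proof -
  let ?g = "\<lambda>b. real (necklaces n e (n div b)) / real b"
  have "real (n choose e) / real n = (\<Sum>b | b dvd n \<and> b dvd e. ?g b)"
    using binomial_necklaces[OF n, of 1 e] n
    by (simp add: sum_divide_distrib) (intro sum.cong, auto simp: real_of_nat_div)
  also have "{b. b dvd n \<and> b dvd e} = insert 1 {b. b dvd e \<and> b dvd n \<and> b > 1}"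
    using n by (auto dest: dvd_pos_nat simp: Suc_lessI)
  also have "sum ?g \<dots> = ?g 1 + (\<Sum>b | b dvd e \<and> b dvd n \<and> b > 1. ?g b)"
    using n by (subst sum.insert) auto
  finally show ?thesis
    using n by (simp add: alpha_rec_eq_necklaces[OF n e])
qed

text \<open>Pascal's rule splits \<open>N choose d\<close> according to whether the root 1 is
  omitted or chosen. In each half the correction terms remove the orbits with nontrivial
  stabilizer.\<close>

lemma alpha_1_eq_necklaces:
  assumes n: "n > 0" and d: "1 < d"
  shows "alpha (Suc n) d 1 = real (necklaces n d n + necklaces n (d - 1) n)"
proof -
  have "real (Suc n choose d) = real (n choose d) + real (n choose (d - 1))"
    using d by (cases d) auto
  then have "1 / (real n) * real (Suc n choose d) = real (n choose d) / real n + real (n choose (d - 1)) / real n"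
    using n by (simp add: add_divide_distrib)
  then show ?thesis
    using binomial_alpha_rec[OF n, of d] binomial_alpha_rec[OF n, of "d - 1"] d
    by (simp add: alpha_def)
qed

lemma alpha_in_Nats:
  assumes n: "n > 0" and d: "1 < d" and c: "c dvd n" "c dvd d \<or> c dvd d - 1"
  shows "alpha (Suc n) d c \<in> \<nat>"
proof (cases "c = 1")
  case True
  then show ?thesis using alpha_1_eq_necklaces[OF n d] by simp
next
  case False
  then show ?thesis using c n d
    by (auto simp: alpha_def alpha_rec_eq_necklaces[OF n])
qed

lemma sum_alpha:
  assumes n: "n > 0" and d: "1 < d"
  shows "alpha (Suc n) d 1
      + (\<Sum>c | c dvd d \<and> c dvd n \<and> c > 1. alpha (Suc n) d c)
      + (\<Sum>c | c dvd d - 1 \<and> c dvd n \<and> c > 1. alpha (Suc n) d c) =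
    real (\<Sum>p | p dvd n. necklaces n d p + necklaces n (d - 1) p)"
proof -
  \<comment> \<open>As \<open>d\<close> and \<open>d - 1\<close> are coprime, \<open>alpha\<close>
    takes its last branch for these \<open>c\<close>.\<close>
  have "\<not> c dvd d" if "c dvd d - 1" "c > 1" for c
    using that d by (metis dvd_diffD1 less_imp_le_nat nat_dvd_1_iff_1 nat_neq_iff)
  then have "(\<Sum>c | c dvd d - 1 \<and> c dvd n \<and> c > 1. alpha (Suc n) d c) =
      (\<Sum>c | c dvd d - 1 \<and> c dvd n \<and> c > 1. alpha_rec (Suc n) (d - 1) c)"
    by (intro sum.cong) (auto simp: alpha_def)
  moreover have "(\<Sum>c | c dvd d \<and> c dvd n \<and> c > 1. alpha (Suc n) d c) =
      (\<Sum>c | c dvd d \<and> c dvd n \<and> c > 1. alpha_rec (Suc n) d c)"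
    by (intro sum.cong) (auto simp: alpha_def)
  ultimately show ?thesis
    using sum_alpha_rec[OF n, of d] sum_alpha_rec[OF n, of "d - 1"] d
      alpha_1_eq_necklaces[OF n d]
    by (simp add: sum.distrib)
qed

section \<open>Harmonic frames of prime order\<close>

lemma (in group) prime_order_generator:
  assumes "finite (carrier G)" "prime (card (carrier G))"
  obtains x where "x \<in> carrier G" "x [^] card (carrier G) = \<one>"
    "carrier G = (\<lambda>k::nat. x [^] k) ` {..<card (carrier G)}"
proof -
  let ?N = "card (carrier G)"
  have "?N > 1" using assms(2) prime_gt_1_nat by blast
  then have "carrier G \<noteq> {\<one>}" by auto
  then obtain x where x: "x \<in> carrier G" "x \<noteq> \<one>" by (metis is_singletonI' is_singleton_the_elem one_closed empty_iff singletonD)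
  have "ord x dvd ?N" using ord_dvd_group_order[OF x(1)] by (simp add: Coset.order_def)
  moreover have "ord x \<noteq> 1" using x ord_eq_1 by blast
  ultimately have o: "ord x = ?N" using assms(2) prime_nat_iff by blast
  have "{..<?N} = {0..ord x - 1}" using o \<open>?N > 1\<close> by auto
  then have "inj_on (\<lambda>k::nat. x [^] k) {..<?N}" using ord_inj[OF x(1)] by simp
  then have "(\<lambda>k::nat. x [^] k) ` {..<?N} = carrier G"
    using x(1) assms(1) by (intro card_subset_eq) (auto simp: card_image)
  then show thesis using that[of x] x(1) o pow_ord_eq_1[OF x(1)] by simp
qed

lemma Units_complex: "Units (ring_of_type_algebra :: complex ring) = - {0}"
proof -
  have "\<exists>y. x * y = 1" if "x \<noteq> 0" for x :: complex
    using that by (intro exI[of _ "inverse x"]) simp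
  then show ?thesis by (auto simp: Units_def ring_of_type_algebra_def mult.commute)
qed

lemma in_characters_iff:
  "\<chi> \<in> characters G \<longleftrightarrow>
    (\<forall>x\<in>carrier G. \<chi> x \<noteq> 0) \<and> (\<forall>x\<in>carrier G. \<forall>y\<in>carrier G. \<chi> (x \<otimes>\<^bsub>G\<^esub> y) = \<chi> x * \<chi> y)
    \<and> \<chi> \<in> extensional (carrier G)"
  by (auto simp: characters_def hom_def units_of_def Units_complex)
    (auto simp: ring_of_type_algebra_def)

lemma character_nat_pow:
  fixes k :: nat
  assumes "group G" "\<chi> \<in> characters G" "x \<in> carrier G"
  shows "\<chi> (x [^]\<^bsub>G\<^esub> k) = \<chi> x ^ k"
proof -
  interpret group G by fact
  have "\<chi> \<one>\<^bsub>G\<^esub> * \<chi> \<one>\<^bsub>G\<^esub> = \<chi> \<one>\<^bsub>G\<^esub>" "\<chi> \<one>\<^bsub>G\<^esub> \<noteq> 0"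
    using assms(2) by (metis in_characters_iff one_closed l_one, auto simp: in_characters_iff)
  then have "\<chi> \<one>\<^bsub>G\<^esub> = 1" by simp
  then show ?thesis using assms(2,3) by (induction k) (auto simp: in_characters_iff mult.commute)
qed

definition frame_vec :: "nat \<Rightarrow> (nat \<Rightarrow> complex) \<Rightarrow> nat \<Rightarrow> complex vec" where
  "frame_vec d s k = vec d (\<lambda>j. s j ^ k)"

lemma frame_vec_carrier [simp]: "frame_vec d s k \<in> carrier_vec d"
  by (simp add: frame_vec_def)

text \<open>A relation and not a function, because the root set depends on the chosen generator of
  the group: another generator replaces \<open>S\<close> by its image under a power map. The vector
  with index \<open>k\<close> belongs to the \<open>k\<close>-th power of the generator.\<close>

definition frame_of_roots :: "nat \<Rightarrow> nat \<Rightarrow> complex vec set \<Rightarrow> complex set \<Rightarrow> bool" where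
  "frame_of_roots N d \<Phi> S \<longleftrightarrow>
    (\<exists>s U. bij_betw s {..<d} S \<and> unitary d U \<and> \<Phi> = (\<lambda>k. U *\<^sub>v frame_vec d s k) ` {..<N})"

text \<open>A character is determined by its value at a generator \<open>x\<close>, and this value
  is an \<open>N\<close>-th root of unity. So distinct characters give distinct roots
  \<open>s j\<close>, and the coordinates at the \<open>k\<close>-th power of \<open>x\<close> are
  the \<open>s j ^ k\<close>.\<close>

lemma harmonic_frame_imp_roots:
  assumes N: "prime N" and "\<Phi> \<in> harmonic_frames N d"
  obtains S where "S \<in> ksubsets {z. z ^ N = 1} d" "frame_of_roots N d \<Phi> S"
proof -
  obtain G :: "nat monoid" and J \<xi> U where G: "comm_group G" "finite (carrier G)" "card (carrier G) = N"
    and J: "J \<subseteq> characters G" "bij_betw \<xi> {..<d} J" "unitary d U"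
    and Phi: "\<Phi> = (\<lambda>g. U *\<^sub>v vec d (\<lambda>j. \<xi> j g)) ` carrier G"
    using assms(2) by (auto simp: harmonic_frames_def harmonic_frame_of_def)
  interpret comm_group G by fact
  obtain x where x: "x \<in> carrier G" "x [^]\<^bsub>G\<^esub> N = \<one>\<^bsub>G\<^esub>" "carrier G = (\<lambda>k::nat. x [^]\<^bsub>G\<^esub> k) ` {..<N}"
    using prime_order_generator[OF G(2)] N G(3) by metis
  have pow: "\<chi> (x [^]\<^bsub>G\<^esub> k) = \<chi> x ^ k" if "\<chi> \<in> characters G" for \<chi> and k :: nat
    using character_nat_pow[OF is_group that x(1)] .
  have xi: "\<xi> j \<in> characters G" if "j < d" for j
    using J that unfolding bij_betw_def by auto
  define s where "s = (\<lambda>j. \<xi> j x)"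
  have inj: "inj_on s {..<d}"
  proof (rule inj_onI)
    fix i j assume ij: "i \<in> {..<d}" "j \<in> {..<d}" and e: "s i = s j"
    have "\<xi> i = \<xi> j"
    proof (rule extensionalityI[of _ "carrier G"])
      fix y assume "y \<in> carrier G"
      then obtain k :: nat where "y = x [^]\<^bsub>G\<^esub> k" using x(3) by blast
      then show "\<xi> i y = \<xi> j y" using pow[OF xi, of i k] pow[OF xi, of j k] ij e by (simp add: s_def)
    qed (use xi[of i] xi[of j] ij in \<open>auto simp: in_characters_iff\<close>)
    then show "i = j" using J(2) ij by (auto simp: bij_betw_def inj_on_def)
  qed
  have "s j ^ N = 1" if "j < d" for j
  proof -
    have "s j ^ N = \<xi> j (x [^]\<^bsub>G\<^esub> (0::nat))"
      using pow[OF xi[OF that], of N] x(2) by (simp add: s_def)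
    then show ?thesis using pow[OF xi[OF that], of 0] by simp
  qed
  then have "s ` {..<d} \<in> ksubsets {z. z ^ N = 1} d"
    using inj by (auto simp: ksubsets_def card_image)
  moreover have "\<Phi> = (\<lambda>k. U *\<^sub>v frame_vec d s k) ` {..<N}"
    unfolding Phi x(3) image_image
    by (intro image_cong refl arg_cong[of _ _ "\<lambda>v. U *\<^sub>v v"])
      (auto simp: frame_vec_def s_def pow xi intro!: eq_vecI)
  then have "frame_of_roots N d \<Phi> (s ` {..<d})"
    unfolding frame_of_roots_def using inj J(3) by (blast intro: inj_on_imp_bij_betw)
  ultimately show thesis by (rule that)
qed

lemma power_mod_root:
  fixes z :: complex
  assumes "z ^ N = 1" shows "z ^ (k mod N) = z ^ k"
proof -
  have "z ^ k = z ^ (N * (k div N) + k mod N)" by simp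
  also have "\<dots> = z ^ (k mod N)" unfolding power_add power_mult using assms by simp
  finally show ?thesis by simp
qed

text \<open>Realised over the integers modulo \<open>N\<close>, where a root \<open>z\<close>
  defines the character sending \<open>k\<close> to \<open>z ^ k\<close>. Evaluation at 1 recovers
  the root.\<close>

lemma roots_imp_harmonic_frame:
  assumes N: "N > 1" and S: "S \<subseteq> {z. z ^ N = 1}" and fr: "frame_of_roots N d \<Phi> S"
  shows "\<Phi> \<in> harmonic_frames N d"
proof -
  obtain s U where s: "bij_betw s {..<d} S" and U: "unitary d U"
    and Phi: "\<Phi> = (\<lambda>k. U *\<^sub>v frame_vec d s k) ` {..<N}"
    using fr by (auto simp: frame_of_roots_def)
  define G where "G = \<lparr>carrier = {..<N}, monoid.mult = (\<lambda>x y. (x + y) mod N), one = 0\<rparr>"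
  have carG: "carrier G = {..<N}" by (simp add: G_def)
  have G: "comm_group G"
  proof (rule comm_groupI)
    show "\<exists>y\<in>carrier G. y \<otimes>\<^bsub>G\<^esub> x = \<one>\<^bsub>G\<^esub>" if "x \<in> carrier G" for x
      using that N by (intro bexI[of _ "(N - x) mod N"]) (auto simp: G_def mod_add_left_eq)
  qed (use N in \<open>auto simp: G_def mod_add_left_eq mod_add_right_eq add_ac\<close>)
  have root: "s j ^ N = 1" if "j < d" for j using s S that by (auto simp: bij_betw_def)
  define \<xi> where "\<xi> = (\<lambda>j. restrict (\<lambda>k. s j ^ k) {..<N})"
  have xi: "\<xi> j \<in> characters G" if "j < d" for j
  proof -
    have "s j \<noteq> 0" using root[OF that] N by (auto simp: power_0_left)
    then show ?thesis using root[OF that] N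
      by (auto simp: in_characters_iff G_def \<xi>_def power_mod_root power_add)
  qed
  have inj: "inj_on \<xi> {..<d}"
  proof (rule inj_onI)
    fix i j assume ij: "i \<in> {..<d}" "j \<in> {..<d}" "\<xi> i = \<xi> j"
    then have "\<xi> i 1 = \<xi> j 1" by simp
    then have "s i = s j" using N by (simp add: \<xi>_def)
    then show "i = j" using s ij by (auto simp: bij_betw_def inj_on_def)
  qed
  have "harmonic_frame_of G d \<Phi>"
    unfolding harmonic_frame_of_def
  proof (intro exI conjI)
    show "\<xi> ` {..<d} \<subseteq> characters G" using xi by auto
    show "card (\<xi> ` {..<d}) = d" using inj by (simp add: card_image)
    show "bij_betw \<xi> {..<d} (\<xi> ` {..<d})" using inj by (rule inj_on_imp_bij_betw)
    show "\<Phi> = (\<lambda>g. U *\<^sub>v vec d (\<lambda>j. \<xi> j g)) ` carrier G"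
      unfolding Phi carG
      by (intro image_cong refl arg_cong[of _ _ "\<lambda>v. U *\<^sub>v v"])
        (auto simp: frame_vec_def \<xi>_def intro!: eq_vecI)
  qed fact
  moreover have "finite (carrier G)" "card (carrier G) = N" by (auto simp: carG)
  ultimately show ?thesis using G by (auto simp: harmonic_frames_def)
qed

section \<open>Unitary equivalence in terms of power maps\<close>

lemma unitary_cscalar_prod:
  assumes U: "unitary d U" and v: "v \<in> carrier_vec d" and w: "w \<in> carrier_vec d"
  shows "(U *\<^sub>v v) \<bullet>c (U *\<^sub>v w) = v \<bullet>c w"
proof -
  have c: "U \<in> carrier_mat d d" and UU: "mat_adjoint U * U = 1\<^sub>m d" using U by (auto simp: unitary_def)
  \<comment> \<open>The columns of \<open>U\<close> are orthonormal; the sums below are interchanged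
    until this applies.\<close>
  have orth: "(\<Sum>i<d. cnj (U $$ (i, k)) * U $$ (i, j)) = of_bool (k = j)" if "j < d" "k < d" for j k
  proof -
    have "(\<Sum>i<d. cnj (U $$ (i, k)) * U $$ (i, j)) = (mat_adjoint U * U) $$ (k, j)"
      using that c by (auto simp: scalar_prod_def mat_adjoint_def mat_of_rows_def atLeast0LessThan intro!: sum.cong)
    then show ?thesis using that by (simp add: UU)
  qed
  have ent: "(U *\<^sub>v x) $ i = (\<Sum>j<d. U $$ (i, j) * x $ j)" if "x \<in> carrier_vec d" "i < d" for x i
    using that c by (auto simp: scalar_prod_def atLeast0LessThan intro!: sum.cong)
  have "(U *\<^sub>v v) \<bullet>c (U *\<^sub>v w) = (\<Sum>i<d. (U *\<^sub>v v) $ i * cnj ((U *\<^sub>v w) $ i))"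
    using c by (auto simp: scalar_prod_def atLeast0LessThan intro!: sum.cong)
  also have "\<dots> = (\<Sum>i<d. \<Sum>j<d. \<Sum>k<d. v $ j * cnj (w $ k) * (cnj (U $$ (i, k)) * U $$ (i, j)))"
    by (simp add: ent[OF v] ent[OF w] sum_product mult_ac)
  also have "\<dots> = (\<Sum>j<d. \<Sum>i<d. \<Sum>k<d. v $ j * cnj (w $ k) * (cnj (U $$ (i, k)) * U $$ (i, j)))"
    by (rule sum.swap)
  also have "\<dots> = (\<Sum>j<d. \<Sum>k<d. \<Sum>i<d. v $ j * cnj (w $ k) * (cnj (U $$ (i, k)) * U $$ (i, j)))"
    by (rule sum.cong[OF refl], rule sum.swap)
  also have "\<dots> = (\<Sum>j<d. \<Sum>k<d. v $ j * cnj (w $ k) * (\<Sum>i<d. cnj (U $$ (i, k)) * U $$ (i, j)))"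
    by (simp only: sum_distrib_left)
  also have "\<dots> = (\<Sum>j<d. \<Sum>k<d. if j = k then v $ j * cnj (w $ k) else 0)"
    by (intro sum.cong refl) (simp add: orth)
  also have "\<dots> = (\<Sum>j<d. v $ j * cnj (w $ j))"
    by simp
  also have "\<dots> = v \<bullet>c w"
    using v w by (auto simp: scalar_prod_def atLeast0LessThan intro!: sum.cong)
  finally show ?thesis .
qed

lemma unitary_inj:
  assumes U: "unitary d U" and v: "v \<in> carrier_vec d" "w \<in> carrier_vec d" and e: "U *\<^sub>v v = U *\<^sub>v w"
  shows "v = w"
proof -
  have c: "U \<in> carrier_mat d d" "mat_adjoint U \<in> carrier_mat d d"
    using U unitary_adjoint[OF U] by (auto simp: unitary_def)
  have "mat_adjoint U *\<^sub>v (U *\<^sub>v x) = x" if "x \<in> carrier_vec d" for x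
    using assoc_mult_mat_vec[OF c(2,1) that] U that by (simp add: unitary_def)
  then show ?thesis using v e by metis
qed

text \<open>Conjugation inverts a root of unity, so the conjugate of \<open>z ^ b\<close> is
  \<open>z ^ (N - b)\<close>. The exponent \<open>a + (N - b)\<close> stands for
  \<open>a - b\<close> modulo \<open>N\<close>.\<close>

lemma cscalar_prod_frame_vec:
  assumes "\<And>j. j < d \<Longrightarrow> s j ^ N = 1" and "b \<le> N" "N > 0"
  shows "frame_vec d s a \<bullet>c frame_vec d s b = (\<Sum>j<d. s j ^ (a + (N - b)))"
proof -
  have "s j ^ a * cnj (s j ^ b) = s j ^ (a + (N - b))" if "j < d" for j
  proof -
    have z: "s j ^ N = 1" using assms(1) that by blast
    then have "norm (s j) = 1" using power_eq_1_iff[OF z] assms(3) by auto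
    then have "s j * cnj (s j) = 1"
      by (simp add: complex_norm_square[symmetric])
    then have "s j ^ b * cnj (s j ^ b) = 1"
      by (simp flip: power_mult_distrib)
    moreover have "s j ^ b * s j ^ (N - b) = 1"
      using z assms(2) by (simp flip: power_add)
    ultimately have "cnj (s j ^ b) = s j ^ (N - b)"
      by (metis mult.commute mult.left_commute mult.right_neutral)
    then show ?thesis by (simp add: power_add)
  qed
  then show ?thesis
    by (simp add: frame_vec_def scalar_prod_def atLeast0LessThan)
qed

text \<open>The power map is undone by the exponent \<open>v\<close> inverse to \<open>u\<close>
  modulo \<open>N\<close>.\<close>

lemma inj_on_power_roots:
  assumes "prime N" "\<not> N dvd u"
  shows "inj_on (\<lambda>z::complex. z ^ u) {z. z ^ N = 1}"
proof -
  have "coprime u N" using assms by (simp add: coprime_commute prime_imp_coprime)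
  then obtain v where "[u * v = Suc 0] (mod N)" using cong_solve_coprime_nat by blast
  then have uv: "u * v mod N = 1" using prime_gt_1_nat[OF assms(1)] by (simp add: cong_def)
  have "(z ^ u) ^ v = z" if "z ^ N = 1" for z :: complex
    using power_mod_root[OF that, of "u * v"] uv by (simp add: power_mult)
  then show ?thesis by (intro inj_on_inverseI[where g = "\<lambda>z. z ^ v"]) simp
qed

text \<open>A unitary map preserves inner products. The product of the vectors with indices 1 and 0
  of the first frame is the sum of \<open>S\<close>; it equals a product of two vectors of the
  second frame, which is the sum of the \<open>u\<close>-th powers of \<open>S'\<close>. By
  \<open>sum_roots_of_unity_inj\<close> the sum determines the set.\<close>

lemma equivalent_frames_imp_roots:
  assumes N: "prime N" and d: "d \<ge> 2"
    and S: "S \<in> ksubsets {z. z ^ N = 1} d" "S' \<in> ksubsets {z. z ^ N = 1} d"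
    and fr: "frame_of_roots N d \<Phi> S" "frame_of_roots N d \<Psi> S'"
    and V: "unitary d V" "\<Phi> = (\<lambda>v. V *\<^sub>v v) ` \<Psi>"
  shows "\<exists>u. \<not> N dvd u \<and> S = (\<lambda>z. z ^ u) ` S'"
proof -
  obtain s U where s: "bij_betw s {..<d} S" and U: "unitary d U"
    and Phi: "\<Phi> = (\<lambda>k. U *\<^sub>v frame_vec d s k) ` {..<N}"
    using fr(1) by (auto simp: frame_of_roots_def)
  obtain s' U' where s': "bij_betw s' {..<d} S'" and U': "unitary d U'"
    and Psi: "\<Psi> = (\<lambda>k. U' *\<^sub>v frame_vec d s' k) ` {..<N}"
    using fr(2) by (auto simp: frame_of_roots_def)
  have N1: "N > 1" using N prime_gt_1_nat by blast
  have root: "s j ^ N = 1" "s' j ^ N = 1" if "j < d" for j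
    using s s' S that by (auto simp: bij_betw_def ksubsets_def)
  have U'c: "U' *\<^sub>v frame_vec d s' k \<in> carrier_vec d" for k
    using U' by (auto simp: unitary_def)
  have "\<exists>a<N. U *\<^sub>v frame_vec d s k = V *\<^sub>v (U' *\<^sub>v frame_vec d s' a)" if "k < N" for k
    using that V(2) Phi Psi by blast
  from this[of 1] this[of 0] N1 obtain a b where
    a: "a < N" "U *\<^sub>v frame_vec d s 1 = V *\<^sub>v (U' *\<^sub>v frame_vec d s' a)"
    and b: "b < N" "U *\<^sub>v frame_vec d s 0 = V *\<^sub>v (U' *\<^sub>v frame_vec d s' b)"
    by auto
  define u where "u = a + (N - b)"
  have "frame_vec d s 1 \<bullet>c frame_vec d s 0 = frame_vec d s' a \<bullet>c frame_vec d s' b"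
    using unitary_cscalar_prod[OF U, of "frame_vec d s 1" "frame_vec d s 0"]
      unitary_cscalar_prod[OF V(1) U'c U'c, of a b]
      unitary_cscalar_prod[OF U', of "frame_vec d s' a" "frame_vec d s' b"] a(2) b(2) by simp
  then have "(\<Sum>j<d. s j ^ (1 + (N - 0))) = (\<Sum>j<d. s' j ^ u)"
    using root N1 b(1) unfolding u_def by (simp add: cscalar_prod_frame_vec[where N = N])
  then have "(\<Sum>j<d. s j) = (\<Sum>j<d. s' j ^ u)"
    using root by simp
  then have sums: "\<Sum>S = (\<Sum>z\<in>S'. z ^ u)"
    using sum.reindex_bij_betw[OF s, of id] sum.reindex_bij_betw[OF s', of "\<lambda>z. z ^ u"] by simp
  \<comment> \<open>Otherwise \<open>a = b\<close>, so the vectors with indices 1 and 0 coincide and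
    every \<open>s j\<close> is 1. This contradicts the presence of two distinct roots, which
    \<open>d \<ge> 2\<close> provides.\<close>
  have nd: "\<not> N dvd u"
  proof
    assume "N dvd u"
    then have "u mod N = 0" by auto
    moreover have "u mod N = (if b \<le> a then a - b else u)"
    proof (cases "b \<le> a")
      case True
      then have "u = (a - b) + N" using b(1) unfolding u_def by simp
      then have "u mod N = a - b" using a(1) by (metis mod_add_self2 mod_less less_imp_diff_less)
      then show ?thesis using True by simp
    qed (use a b in \<open>simp add: u_def\<close>)
    ultimately have "a = b" using b(1) by (auto simp: u_def split: if_splits)
    then have "U *\<^sub>v frame_vec d s 1 = U *\<^sub>v frame_vec d s 0"
      using a(2) b(2) by simp
    then have "frame_vec d s 1 = frame_vec d s 0"
      by (rule unitary_inj[OF U frame_vec_carrier frame_vec_carrier])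
    then have eq: "frame_vec d s 1 $ j = frame_vec d s 0 $ j" for j by simp
    have "s j = 1" if "j < d" for j using eq[of j] that by (simp add: frame_vec_def)
    then have "s 0 = s 1" using d by simp
    moreover have "inj_on s {..<d}" using s by (simp add: bij_betw_def)
    ultimately have "0 = (1 :: nat)" using d by (auto dest!: inj_onD)
    then show False by simp
  qed
  have inj: "inj_on (\<lambda>z. z ^ u) S'"
    using inj_on_subset[OF inj_on_power_roots[OF N nd]] S(2) by (auto simp: ksubsets_def)
  have "S = (\<lambda>z. z ^ u) ` S'"
  proof (rule sum_roots_of_unity_inj[OF N])
    show "(\<lambda>z. z ^ u) ` S' \<subseteq> {z. z ^ N = 1}"
    proof safe
      fix z assume "z \<in> S'"
      then have "z ^ N = 1" using S(2) by (auto simp: ksubsets_def)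
      then show "(z ^ u) ^ N = 1" by (metis mult.commute power_mult power_one)
    qed
  qed (use S inj sums in \<open>auto simp: ksubsets_def card_image sum.reindex\<close>)
  then show ?thesis using nd by blast
qed

lemma permutation_matrix:
  assumes \<pi>: "bij_betw \<pi> {..<d} {..<d}"
  obtains P where "unitary d P" "\<And>v i. v \<in> carrier_vec d \<Longrightarrow> i < d \<Longrightarrow> (P *\<^sub>v v) $ i = v $ \<pi> i"
proof -
  define P :: "complex mat" where "P = mat d d (\<lambda>(i, j). of_bool (j = \<pi> i))"
  have lt: "\<pi> i < d" if "i < d" for i using \<pi> that by (auto simp: bij_betw_def)
  have inj: "\<pi> i = \<pi> j \<longleftrightarrow> i = j" if "i < d" "j < d" for i j
    using \<pi> that by (auto simp: bij_betw_def inj_on_def)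
  have act: "(P *\<^sub>v v) $ i = v $ \<pi> i" if "v \<in> carrier_vec d" "i < d" for v i
    using that lt by (simp add: P_def scalar_prod_def atLeast0LessThan)
  have "P * mat_adjoint P = 1\<^sub>m d"
  proof (rule eq_matI)
    fix i j assume "i < dim_row (1\<^sub>m d :: complex mat)" "j < dim_col (1\<^sub>m d :: complex mat)"
    then show "(P * mat_adjoint P) $$ (i, j) = 1\<^sub>m d $$ (i, j)"
      using lt inj by (auto simp: P_def scalar_prod_def mat_adjoint_def mat_of_rows_def atLeast0LessThan)
  qed (auto simp: P_def mat_adjoint_def)
  moreover have "mat_adjoint P * P = 1\<^sub>m d"
  proof (rule mat_mult_left_right_inverse)
    show "P \<in> carrier_mat d d" "mat_adjoint P \<in> carrier_mat d d"
      by (auto simp: P_def mat_adjoint_def)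
  qed fact
  ultimately have "unitary d P" by (simp add: unitary_def P_def)
  then show thesis using act by (rule that)
qed

text \<open>The frame vector of \<open>s\<close> with index \<open>k\<close> is, up to the order of
  coordinates, that of \<open>s'\<close> with index \<open>u * k mod N\<close>. Since
  \<open>u\<close> is prime to \<open>N\<close>, these indices run through all residues, so the sets
  of vectors agree up to a permutation matrix.\<close>

lemma roots_imp_equivalent_frames:
  assumes N: "prime N"
    and S: "S \<in> ksubsets {z. z ^ N = 1} d" "S' \<in> ksubsets {z. z ^ N = 1} d"
    and fr: "frame_of_roots N d \<Phi> S" "frame_of_roots N d \<Psi> S'"
    and u: "\<not> N dvd u" "S = (\<lambda>z. z ^ u) ` S'"
  shows "\<exists>V. unitary d V \<and> \<Phi> = (\<lambda>v. V *\<^sub>v v) ` \<Psi>"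
proof -
  obtain s U where s: "bij_betw s {..<d} S" and U: "unitary d U"
    and Phi: "\<Phi> = (\<lambda>k. U *\<^sub>v frame_vec d s k) ` {..<N}"
    using fr(1) by (auto simp: frame_of_roots_def)
  obtain s' U' where s': "bij_betw s' {..<d} S'" and U': "unitary d U'"
    and Psi: "\<Psi> = (\<lambda>k. U' *\<^sub>v frame_vec d s' k) ` {..<N}"
    using fr(2) by (auto simp: frame_of_roots_def)
  have N1: "N > 1" using N prime_gt_1_nat by blast
  have root: "s' j ^ N = 1" if "j < d" for j
    using s' S that by (auto simp: bij_betw_def ksubsets_def)
  define t where "t = (\<lambda>j. s' j ^ u)"
  have "inj_on (\<lambda>z. z ^ u) S'"
    using inj_on_subset[OF inj_on_power_roots[OF N u(1)]] S(2) by (auto simp: ksubsets_def)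
  then have "bij_betw (\<lambda>z. z ^ u) S' S" using u(2) by (simp add: bij_betw_def)
  then have t: "bij_betw t {..<d} S"
    using bij_betw_trans[OF s'] by (simp add: t_def comp_def)
  \<comment> \<open>Both \<open>s\<close> and \<open>t\<close> enumerate \<open>S\<close>;
    \<open>\<pi>\<close> is the reordering of coordinates with
    \<open>t (\<pi> j) = s j\<close>.\<close>
  define \<pi> where "\<pi> = inv_into {..<d} t \<circ> s"
  have pi: "bij_betw \<pi> {..<d} {..<d}"
    unfolding \<pi>_def using bij_betw_trans[OF s bij_betw_inv_into[OF t]] .
  have tpi: "t (\<pi> j) = s j" if "j < d" for j
    using that s t by (auto simp: \<pi>_def bij_betw_def f_inv_into_f)
  obtain P where P: "unitary d P" "\<And>v i. v \<in> carrier_vec d \<Longrightarrow> i < d \<Longrightarrow> (P *\<^sub>v v) $ i = v $ \<pi> i"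
    using permutation_matrix[OF pi] by blast
  have Pc: "P \<in> carrier_mat d d" and Uc: "U \<in> carrier_mat d d" and U'c: "U' \<in> carrier_mat d d"
    and U'a: "mat_adjoint U' \<in> carrier_mat d d"
    using P(1) U U' unitary_adjoint[OF U'] by (auto simp: unitary_def)
  have Pv: "frame_vec d s k = P *\<^sub>v frame_vec d s' (u * k mod N)" for k
  proof (rule eq_vecI)
    fix j assume "j < dim_vec (P *\<^sub>v frame_vec d s' (u * k mod N))"
    then have j: "j < d" using Pc by simp
    then have "\<pi> j < d" using pi by (auto simp: bij_betw_def)
    then show "frame_vec d s k $ j = (P *\<^sub>v frame_vec d s' (u * k mod N)) $ j"
      using j tpi[OF j] by (simp add: P(2) frame_vec_def power_mod_root root t_def power_mult flip: tpi)
  qed (use Pc in \<open>simp add: frame_vec_def\<close>)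
  have img: "(\<lambda>k. u * k mod N) ` {..<N} = {..<N}"
  proof (rule endo_inj_surj)
    have "coprime u N" using N u by (simp add: coprime_commute prime_imp_coprime)
    show "inj_on (\<lambda>k. u * k mod N) {..<N}"
    proof (rule inj_onI)
      fix x y assume xy: "x \<in> {..<N}" "y \<in> {..<N}" "u * x mod N = u * y mod N"
      then have "[u * x = u * y] (mod N)" by (simp add: cong_def)
      then have "[x = y] (mod N)" using \<open>coprime u N\<close> by (simp add: cong_mult_lcancel_nat)
      then show "x = y" using xy by (simp add: cong_def)
    qed
  qed (use N1 in auto)
  \<comment> \<open>Undo \<open>U'\<close>, permute the coordinates, then apply
    \<open>U\<close>.\<close>
  let ?V = "U * P * mat_adjoint U'"
  have V: "unitary d ?V" using U P(1) U' by (intro unitary_mult unitary_adjoint)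
  have act: "?V *\<^sub>v (U' *\<^sub>v v) = U *\<^sub>v (P *\<^sub>v v)" if "v \<in> carrier_vec d" for v
  proof -
    have "?V *\<^sub>v (U' *\<^sub>v v) = (U * P) *\<^sub>v (mat_adjoint U' *\<^sub>v (U' *\<^sub>v v))"
      using that Uc Pc U'a U'c by (intro assoc_mult_mat_vec) auto
    also have "mat_adjoint U' *\<^sub>v (U' *\<^sub>v v) = v"
      using assoc_mult_mat_vec[OF U'a U'c that] U' that by (simp add: unitary_def)
    also have "(U * P) *\<^sub>v v = U *\<^sub>v (P *\<^sub>v v)"
      using that Uc Pc by (intro assoc_mult_mat_vec) auto
    finally show ?thesis .
  qed
  have "\<Phi> = (\<lambda>k. U *\<^sub>v (P *\<^sub>v frame_vec d s' k)) ` (\<lambda>k. u * k mod N) ` {..<N}"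
    unfolding Phi image_image Pv ..
  also have "\<dots> = (\<lambda>v. ?V *\<^sub>v v) ` \<Psi>"
    unfolding img Psi image_image by (simp add: act)
  finally show ?thesis using V by blast
qed

section \<open>Power maps as a cyclic action and the count of classes\<close>

lemma funpow_power: "((\<lambda>z::complex. z ^ g) ^^ i) z = z ^ (g ^ i)"
  by (induction i) (auto simp: power_mult[symmetric] mult.commute)

lemma funpow_power_image: "((`) (\<lambda>z::complex. z ^ g) ^^ i) S = (\<lambda>z. z ^ (g ^ i)) ` S"
  unfolding funpow_image by (simp add: funpow_power)

lemma not_dvd_primroot_power:
  assumes N: "prime N" and g: "residue_primroot N g"
  shows "\<not> N dvd g ^ i"
  using g not_prime_unit N by (metis coprime_absorb_left coprime_power_right_iff residue_primroot_def zero_less_iff_neq_zero power_0)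

lemma power_image_in_ksubsets:
  assumes "prime N" "\<not> N dvd u" "S \<in> ksubsets {z. z ^ N = 1} d"
  shows "(\<lambda>z::complex. z ^ u) ` S \<in> ksubsets {z. z ^ N = 1} d"
proof -
  have S: "S \<subseteq> {z. z ^ N = 1}" "card S = d" using assms(3) by (auto simp: ksubsets_def)
  have "(z ^ u) ^ N = 1" if "z ^ N = 1" for z :: complex
    using that by (metis mult.commute power_mult power_one)
  then show ?thesis
    using S inj_on_subset[OF inj_on_power_roots[OF assms(1,2)] S(1)]
    by (auto simp: ksubsets_def card_image)
qed

text \<open>The \<open>i\<close>-th iterate is the power map with exponent \<open>g ^ i\<close>, and
  \<open>g ^ (N - 1)\<close> is 1 modulo \<open>N\<close> by Euler's theorem.\<close>

lemma cyclic_action_power: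
  assumes N: "prime N" and g: "residue_primroot N g"
  shows "cyclic_action (ksubsets {z::complex. z ^ N = 1} d) ((`) (\<lambda>z. z ^ g)) (N - 1)"
proof
  have N1: "N > 1" using N prime_gt_1_nat by blast
  then have "finite {z::complex. z ^ N = 1}" by (intro finite_roots_unity) simp
  then show "finite (ksubsets {z::complex. z ^ N = 1} d)" by (simp add: ksubsets_def)
  show "N - 1 > 0" using N1 by simp
  fix S assume S: "S \<in> ksubsets {z::complex. z ^ N = 1} d"
  show "(\<lambda>z. z ^ g) ` S \<in> ksubsets {z::complex. z ^ N = 1} d"
    using power_image_in_ksubsets[OF N _ S] not_dvd_primroot_power[OF N g, of 1] by simp
  have "[g ^ totient N = 1] (mod N)"
    using g by (intro euler_theorem) (simp add: residue_primroot_def coprime_commute)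
  then have "g ^ (N - 1) mod N = 1" using N1 N by (simp add: cong_def totient_prime)
  then have "z ^ g ^ (N - 1) = z" if "z \<in> S" for z
    using power_mod_root[of z N "g ^ (N - 1)"] that S by (auto simp: ksubsets_def)
  then show "((`) (\<lambda>z. z ^ g) ^^ (N - 1)) S = S" by (simp add: funpow_power_image)
qed

text \<open>On \<open>N\<close>-th roots of unity a power map depends only on its exponent modulo
  \<open>N\<close>, and the powers of a primitive root reach every nonzero residue.\<close>

lemma orbit_rel_power_iff:
  assumes N: "prime N" and g: "residue_primroot N g"
    and S: "S \<in> ksubsets {z::complex. z ^ N = 1} d"
  shows "(S, S') \<in> cyclic_action.orbit_rel (ksubsets {z. z ^ N = 1} d) ((`) (\<lambda>z. z ^ g))
    \<longleftrightarrow> (\<exists>u. \<not> N dvd u \<and> S' = (\<lambda>z. z ^ u) ` S)"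
proof -
  have N1: "N > 1" using N prime_gt_1_nat by blast
  have "\<exists>i. (\<lambda>z. z ^ u) ` S = (\<lambda>z. z ^ (g ^ i)) ` S" if "\<not> N dvd u" for u
  proof -
    have "u mod N \<in> totatives N" using that N N1 by (auto simp: totatives_prime mod_greater_zero_iff_not_dvd)
    then obtain i where "u mod N = g ^ i mod N"
      using residue_primroot_is_generator[OF N1 g] by (auto simp: bij_betw_def)
    moreover have "z ^ N = 1" if "z \<in> S" for z
      using that S by (auto simp: ksubsets_def)
    ultimately have "z ^ u = z ^ (g ^ i)" if "z \<in> S" for z
      using power_mod_root[of z N u] power_mod_root[of z N "g ^ i"] that by simp
    then show ?thesis by (intro exI[of _ i] image_cong) auto
  qed
  moreover have "(S, S') \<in> cyclic_action.orbit_rel (ksubsets {z. z ^ N = 1} d) ((`) (\<lambda>z. z ^ g))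
    \<longleftrightarrow> (\<exists>i. S' = (\<lambda>z. z ^ (g ^ i)) ` S)"
    using S by (simp add: cyclic_action.orbit_rel_def[OF cyclic_action_power[OF N g]] funpow_power_image)
  ultimately show ?thesis
    using not_dvd_primroot_power[OF N g] by metis
qed

text \<open>Made for correspondences that are many-to-many, such as the one between frames and root
  sets. A choice of partners \<open>f\<close> induces the map on classes, which by
  \<open>iff\<close> does not depend on representatives.\<close>

lemma quotient_transfer:
  assumes r: "equiv A r" and s: "equiv B s"
    and P1: "\<And>a. a \<in> A \<Longrightarrow> \<exists>b\<in>B. P a b" and P2: "\<And>b. b \<in> B \<Longrightarrow> \<exists>a\<in>A. P a b"
    and iff: "\<And>a a' b b'. \<lbrakk>a \<in> A; a' \<in> A; b \<in> B; b' \<in> B; P a b; P a' b'\<rbrakk> \<Longrightarrow> (a, a') \<in> r \<longleftrightarrow> (b, b') \<in> s"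
  shows "\<exists>F. bij_betw F (A // r) (B // s)"
proof -
  obtain f where f: "\<And>a. a \<in> A \<Longrightarrow> f a \<in> B \<and> P a (f a)" using P1 by metis
  define F where "F = (\<lambda>C. s `` {f (SOME a. a \<in> C)})"
  have F: "F (r `` {a}) = s `` {f a}" if a: "a \<in> A" for a
  proof -
    have "a \<in> r `` {a}" using equiv_class_self[OF r a] .
    then have "(a, SOME a'. a' \<in> r `` {a}) \<in> r" using someI[of "\<lambda>a'. a' \<in> r `` {a}"] by blast
    moreover from this have "(SOME a'. a' \<in> r `` {a}) \<in> A"
      using equiv_class_eq_iff[OF r] by blast
    ultimately have "(f a, f (SOME a'. a' \<in> r `` {a})) \<in> s" using iff f a by metis
    then show ?thesis unfolding F_def using equiv_class_eq[OF s] by metis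
  qed
  have "bij_betw F (A // r) (B // s)"
  proof (rule bij_betw_imageI)
    show "inj_on F (A // r)"
    proof (rule inj_onI)
      fix C D assume "C \<in> A // r" "D \<in> A // r" and e: "F C = F D"
      then obtain a b where ab: "a \<in> A" "b \<in> A" "C = r `` {a}" "D = r `` {b}" by (auto elim!: quotientE)
      then have "(f a, f b) \<in> s" using e F f eq_equiv_class[OF _ s] by metis
      then have "(a, b) \<in> r" using iff[OF ab(1,2)] f ab by blast
      then show "C = D" using equiv_class_eq[OF r] ab by blast
    qed
    show "F ` (A // r) = B // s"
    proof
      show "F ` (A // r) \<subseteq> B // s" using F f by (auto elim!: quotientE intro!: quotientI)
      show "B // s \<subseteq> F ` (A // r)"
      proof
        fix D assume "D \<in> B // s"
        then obtain b where b: "b \<in> B" "D = s `` {b}" by (auto elim: quotientE)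
        then obtain a where a: "a \<in> A" "P a b" using P2 by blast
        \<comment> \<open>Two partners of the same \<open>a\<close> are equivalent:
          \<open>iff\<close> is applied with both left arguments equal to \<open>a\<close>.\<close>
        have "(f a, b) \<in> s" using iff[OF a(1) a(1), of "f a" b] f a b equiv_class_self[OF r a(1)] by auto
        then have "D = F (r `` {a})" using F[OF a(1)] b equiv_class_eq[OF s] by metis
        then show "D \<in> F ` (A // r)" using a(1) by (auto intro: quotientI)
      qed
    qed
  qed
  then show ?thesis by blast
qed

text \<open>In discrete logarithms to base \<open>g\<close>, the power map rotates the nontrivial
  roots and fixes the root 1. A set without 1 is a \<open>d\<close>-subset of the cycle; a set
  containing 1 is a \<open>(d - 1)\<close>-subset together with 1. Periods agree in both
  cases.\<close>

lemma card_period_roots: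
  assumes N: "prime N" and g: "residue_primroot N g" and d: "d > 0"
  shows "card {S \<in> ksubsets {z::complex. z ^ N = 1} d. period ((`) (\<lambda>z. z ^ g)) S = p} =
    card {A \<in> ksubsets {..<N - 1} d. period (rotate_subset (N - 1)) A = p} +
    card {A \<in> ksubsets {..<N - 1} (d - 1). period (rotate_subset (N - 1)) A = p}"
proof -
  define n where "n = N - 1"
  let ?\<mu> = "{z::complex. z ^ N = 1}"
  let ?T = "(`) (\<lambda>z::complex. z ^ g)"
  have N1: "N > 1" using N prime_gt_1_nat by blast
  then have fin: "finite ?\<mu>" by (intro finite_roots_unity) simp
  obtain \<zeta> where z: "bij_betw (\<lambda>k. \<zeta> ^ k) {..<N} ?\<mu>"
    using roots_of_unity_generator[of N] N1 by auto
  have zN: "\<zeta> ^ N = 1" using bij_betwE[OF z, rule_format, of 1] N1 by simp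
  \<comment> \<open>The discrete exponential: it enumerates the nontrivial roots so that raising to
    the power \<open>g\<close> becomes adding 1 modulo \<open>n\<close>.\<close>
  define y where "y = (\<lambda>a. \<zeta> ^ (g ^ a mod N))"
  have y: "bij_betw y {..<n} (?\<mu> - {1})"
  proof -
    have "bij_betw (\<lambda>i. g ^ i mod N) {..<n} {0<..<N}"
      using residue_primroot_is_generator[OF N1 g] N by (simp add: totient_prime totatives_prime n_def)
    moreover have "bij_betw (\<lambda>k. \<zeta> ^ k) {0<..<N} (?\<mu> - {1})"
    proof (rule bij_betw_imageI)
      show "inj_on (\<lambda>k. \<zeta> ^ k) {0<..<N}"
        using z by (auto simp: bij_betw_def elim: inj_on_subset)
      have "{0<..<N} = {..<N} - {0}" by auto
      then show "(\<lambda>k. \<zeta> ^ k) ` {0<..<N} = ?\<mu> - {1}"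
        using z N1 inj_on_image_set_diff[of "\<lambda>k. \<zeta> ^ k" "{..<N}" "{..<N}" "{0}"]
        by (auto simp: bij_betw_def)
    qed
    ultimately show ?thesis unfolding y_def using bij_betw_trans by (fastforce simp: comp_def)
  qed
  have ypow: "y a ^ (g ^ i) = y ((a + i) mod n)" for a i
  proof -
    have "y a ^ (g ^ i) = \<zeta> ^ ((g ^ a mod N) * g ^ i)" by (simp add: y_def power_mult)
    also have "\<dots> = \<zeta> ^ ((g ^ a mod N) * g ^ i mod N)" by (simp only: power_mod_root[OF zN])
    also have "(g ^ a mod N) * g ^ i mod N = g ^ (a + i) mod N" by (simp add: mod_mult_left_eq power_add)
    \<comment> \<open>The primitive root has multiplicative order \<open>n\<close>, so exponents of
      \<open>g\<close> matter only modulo \<open>n\<close>.\<close>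
    also have "\<dots> = g ^ ((a + i) mod n) mod N"
    proof -
      have "coprime N g" "ord N g = n" using g N by (auto simp: residue_primroot_def totient_prime n_def)
      then have "[g ^ (a + i) = g ^ ((a + i) mod n)] (mod N)"
        using order_divides_expdiff[of N g] by (simp add: cong_def)
      then show ?thesis by (simp add: cong_def)
    qed
    finally show ?thesis by (simp add: y_def)
  qed
  define F where "F = (\<lambda>A. y ` A)"
  define F1 where "F1 = (\<lambda>A. insert 1 (y ` A))"
  have injF: "F A = F B \<longleftrightarrow> A = B" if "A \<subseteq> {..<n}" "B \<subseteq> {..<n}" for A B
    using y that by (auto simp: F_def bij_betw_def inj_on_image_eq_iff)
  have no1: "1 \<notin> y ` A" if "A \<subseteq> {..<n}" for A using y that by (auto simp: bij_betw_def)
  have injF1: "F1 A = F1 B \<longleftrightarrow> A = B" if "A \<subseteq> {..<n}" "B \<subseteq> {..<n}" for A B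
    using injF[OF that] no1 that by (auto simp: F_def F1_def insert_ident)
  have n0: "n > 0" using N1 by (simp add: n_def)
  have rot: "(rotate_subset n ^^ i) A \<subseteq> {..<n}" if "A \<subseteq> {..<n}" for A i
    using that n0 by (auto simp: funpow_rotate_subset)
  have actF: "(?T ^^ i) (F A) = F ((rotate_subset n ^^ i) A)" if "A \<subseteq> {..<n}" for A i
    using that by (simp add: funpow_power_image F_def funpow_rotate_subset image_image ypow)
  have actF1: "(?T ^^ i) (F1 A) = F1 ((rotate_subset n ^^ i) A)" if "A \<subseteq> {..<n}" for A i
    using actF[OF that, of i] by (simp add: funpow_power_image F_def F1_def)
  \<comment> \<open>\<open>F\<close> is injective and intertwines all iterates of the two actions,
    so the same iterates fix \<open>A\<close> and \<open>F A\<close>.\<close>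
  have perF: "period ?T (F A) = period (rotate_subset n) A" if "A \<subseteq> {..<n}" for A
    unfolding period_def using injF[OF rot[OF that] that] actF[OF that] by simp
  have perF1: "period ?T (F1 A) = period (rotate_subset n) A" if "A \<subseteq> {..<n}" for A
    unfolding period_def using injF1[OF rot[OF that] that] actF1[OF that] by simp
  have cardF: "card (F A) = card A" if "A \<subseteq> {..<n}" for A
    unfolding F_def using y that by (intro card_image) (auto simp: bij_betw_def elim: inj_on_subset)
  have finA: "finite A" if "A \<subseteq> {..<n}" for A using that finite_subset by blast
  have cardF1: "card (F1 A) = Suc (card A)" if "A \<subseteq> {..<n}" for A
    using cardF[OF that] no1[OF that] finA[OF that] by (simp add: F_def F1_def)
  let ?W = "\<lambda>e. {A \<in> ksubsets {..<n} e. period (rotate_subset n) A = p}"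
  have Fex: "\<exists>A\<subseteq>{..<n}. B = F A" if "B \<subseteq> ?\<mu> - {1}" for B
    using that y subset_image_iff[of B y "{..<n}"] by (simp add: F_def bij_betw_def)
  have Fin: "F A \<subseteq> ?\<mu>" "F1 A \<subseteq> ?\<mu>" if "A \<subseteq> {..<n}" for A
    using that y by (auto simp: F_def F1_def bij_betw_def)
  have eq: "{S \<in> ksubsets ?\<mu> d. period ?T S = p} = F ` ?W d \<union> F1 ` ?W (d - 1)"
  proof
    show "{S \<in> ksubsets ?\<mu> d. period ?T S = p} \<subseteq> F ` ?W d \<union> F1 ` ?W (d - 1)"
    proof
      fix S assume "S \<in> {S \<in> ksubsets ?\<mu> d. period ?T S = p}"
      then have S: "S \<subseteq> ?\<mu>" "card S = d" "period ?T S = p" by (auto simp: ksubsets_def)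
      show "S \<in> F ` ?W d \<union> F1 ` ?W (d - 1)"
      proof (cases "1 \<in> S")
        case False
        then obtain A where "A \<subseteq> {..<n}" "S = F A" using S(1) Fex[of S] by auto
        then show ?thesis using S cardF perF by (auto simp: ksubsets_def)
      next
        case True
        then obtain A where A: "A \<subseteq> {..<n}" "S - {1} = F A" using S(1) Fex[of "S - {1}"] by auto
        then have "S = F1 A" using True by (auto simp: F_def F1_def)
        then show ?thesis using S cardF1[OF A(1)] perF1[OF A(1)] A(1) by (auto simp: ksubsets_def)
      qed
    qed
    show "F ` ?W d \<union> F1 ` ?W (d - 1) \<subseteq> {S \<in> ksubsets ?\<mu> d. period ?T S = p}"
      using Fin cardF cardF1 perF perF1 d by (auto simp: ksubsets_def)
  qed
  have "card (F ` ?W d \<union> F1 ` ?W (d - 1)) = card (F ` ?W d) + card (F1 ` ?W (d - 1))"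
  proof (rule card_Un_disjoint)
    show "F ` ?W d \<inter> F1 ` ?W (d - 1) = {}"
    proof -
      have "1 \<notin> S" if "S \<in> F ` ?W d" for S using that no1 by (auto simp: ksubsets_def F_def)
      moreover have "1 \<in> S" if "S \<in> F1 ` ?W (d - 1)" for S using that by (auto simp: F1_def)
      ultimately show ?thesis by blast
    qed
  qed (auto simp: ksubsets_def)
  also have "card (F ` ?W d) = card (?W d)"
    using injF by (intro card_image inj_onI) (auto simp: ksubsets_def)
  also have "card (F1 ` ?W (d - 1)) = card (?W (d - 1))"
    using injF1 by (intro card_image inj_onI) (auto simp: ksubsets_def)
  finally show ?thesis unfolding eq n_def .
qed

text \<open>Frame classes correspond to orbits of root sets under power maps. For each period these
  orbits are compared with the orbits of rotation by counting the points of that period on both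
  sides.\<close>

lemma card_frame_classes:
  assumes N: "prime N" and d: "1 < d"
  shows "finite (harmonic_frames N d // frame_equiv N d)"
    "card (harmonic_frames N d // frame_equiv N d) =
      (\<Sum>p | p dvd N - 1. necklaces (N - 1) d p + necklaces (N - 1) (d - 1) p)"
proof -
  let ?Y = "ksubsets {z::complex. z ^ N = 1} d"
  have N1: "N > 1" using N prime_gt_1_nat by blast
  obtain g where g: "residue_primroot N g" using prime_primitive_root_exists[OF N1 N] by blast
  interpret cyclic_action ?Y "(`) (\<lambda>z. z ^ g)" "N - 1"
    by (rule cyclic_action_power[OF N g])
  have "\<exists>F. bij_betw F (harmonic_frames N d // frame_equiv N d) (?Y // orbit_rel)"
  proof (rule quotient_transfer[where P = "frame_of_roots N d"])
    show "\<exists>S\<in>?Y. frame_of_roots N d \<Phi> S" if "\<Phi> \<in> harmonic_frames N d" for \<Phi>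
      using harmonic_frame_imp_roots[OF N that] by blast
    show "\<exists>\<Phi>\<in>harmonic_frames N d. frame_of_roots N d \<Phi> S" if S: "S \<in> ?Y" for S
    proof -
      have S': "S \<subseteq> {z. z ^ N = 1}" "card S = d" using S by (auto simp: ksubsets_def)
      then have "finite S" using d card.infinite by fastforce
      then obtain s where "bij_betw s {..<d} S"
        using ex_bij_betw_nat_finite[of S] S'(2) by (auto simp: atLeast0LessThan)
      then have "frame_of_roots N d ((\<lambda>k. 1\<^sub>m d *\<^sub>v frame_vec d s k) ` {..<N}) S"
        unfolding frame_of_roots_def using unitary_one by blast
      then show ?thesis using roots_imp_harmonic_frame[OF N1 S'(1)] by blast
    qed
    fix \<Phi> \<Psi> S S'
    assume P: "\<Phi> \<in> harmonic_frames N d" "\<Psi> \<in> harmonic_frames N d" and S: "S \<in> ?Y" "S' \<in> ?Y"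
      and fr: "frame_of_roots N d \<Phi> S" "frame_of_roots N d \<Psi> S'"
    have "(\<Phi>, \<Psi>) \<in> frame_equiv N d \<longleftrightarrow> (\<exists>u. \<not> N dvd u \<and> S = (\<lambda>z. z ^ u) ` S')"
      using equivalent_frames_imp_roots[OF N _ S fr] roots_imp_equivalent_frames[OF N S fr] P d
      by (auto simp: frame_equiv_def)
    also have "\<dots> \<longleftrightarrow> (S', S) \<in> orbit_rel"
      using orbit_rel_power_iff[OF N g S(2)] by simp
    \<comment> \<open>The power map obtained leads from \<open>S'\<close> to \<open>S\<close>, so
      the orbit relation is reversed by symmetry.\<close>
    also have "\<dots> \<longleftrightarrow> (S, S') \<in> orbit_rel"
      using equiv_orbit_rel by (auto simp: equiv_def dest: symD)
    finally show "(\<Phi>, \<Psi>) \<in> frame_equiv N d \<longleftrightarrow> (S, S') \<in> orbit_rel" .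
  qed (fact equiv_frame_equiv equiv_orbit_rel)+
  then obtain F where F: "bij_betw F (harmonic_frames N d // frame_equiv N d) (?Y // orbit_rel)" ..
  have "finite (?Y // orbit_rel)" using fin by (simp add: quotient_def)
  then show "finite (harmonic_frames N d // frame_equiv N d)" using bij_betw_finite[OF F] by blast
  have "card (orbits_of_period p) = necklaces (N - 1) d p + necklaces (N - 1) (d - 1) p"
    if "p dvd N - 1" for p
  proof -
    \<comment> \<open>Both sides count root sets of period \<open>p\<close>; the factor
      \<open>p\<close> cancels because a divisor of \<open>N - 1\<close> is positive.\<close>
    have "p * card (orbits_of_period p) = p * (necklaces (N - 1) d p + necklaces (N - 1) (d - 1) p)"
      using card_period[of p] card_period_roots[OF N g, of d p] d n
      by (simp add: card_period_rotate_subset distrib_left)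
    then show ?thesis using that n by (auto dest: dvd_pos_nat)
  qed
  then show "card (harmonic_frames N d // frame_equiv N d) =
      (\<Sum>p | p dvd N - 1. necklaces (N - 1) d p + necklaces (N - 1) (d - 1) p)"
    using bij_betw_same_card[OF F] card_quotient by simp
qed

theorem theorem2p6:
  fixes N d :: nat
  assumes "prime N" and "1 < d" and "d < N"
  shows "(\<forall>c. c dvd N - 1 \<and> (c dvd d \<or> c dvd d - 1) \<longrightarrow> alpha N d c \<in> \<nat>) \<and>
    finite (harmonic_frames N d // frame_equiv N d) \<and>
    real (card (harmonic_frames N d // frame_equiv N d)) =
      alpha N d 1
      + (\<Sum>c | c dvd d \<and> c dvd N - 1 \<and> c > 1. alpha N d c)
      + (\<Sum>c | c dvd d - 1 \<and> c dvd N - 1 \<and> c > 1. alpha N d c)"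
proof -
  have "N > 1" using prime_gt_1_nat[OF assms(1)] .
  then obtain n where N: "N = Suc n" and n: "n > 0" by (cases N) auto
  show ?thesis
    using alpha_in_Nats[OF n assms(2)] sum_alpha[OF n assms(2)] card_frame_classes[OF assms(1,2)]
    unfolding N by simp
qed

end
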